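(* Let $n\ge 4$, $d\ge 1$, and let $f=(f_1,\dots,f_d):\mathbb{S}_n/\mathbb{S}_{n-2}\to\mathbb{C}^d$, i.e. $f:\mathbb{S}_n\to\mathbb{C}^d$ with $f(\sigma h)=f(\sigma)$ for all $\sigma\in\mathbb{S}_n$, $h\in\mathbb{S}_{n-2}$ (given by its table of values on the cosets). Then the reduced Multi-Orbit Skew Spectrum of $f$ can be computed in $O(d^2n^3+d^3n^2)$ operations, and it has at most $49\,d^3$ non-zero scalar entries in total.
   Context: $\mathbb{S}_n$ is the symmetric group on $\{1,\dots,n\}$, with product $(g_1g_2)(i)=g_1(g_2(i))$; $\mathbb{S}_{n-2}\le\mathbb{S}_n$ is the subgroup fixing $n-1$ and $n$. Irreducible representations (irreps) $\rho$ of $\mathbb{S}_n$ are indexed by partitions of $n$ and realized as Young's orthogonal representation (real orthogonal matrices, adapted to the chain $\mathbb{S}_n\ge\mathbb{S}_{n-1}\ge\dots\ge\mathbb{S}_1$). $\Lambda_n$ denotes the set of the four irreps indexed by $(n),(n-1,1),(n-2,2),(n-2,1,1)$. The Fourier transform of $\phi:\mathbb{S}_n\to\mathbb{C}$ is $\hat\phi(\rho)=\frac{1}{|\mathbb{S}_n|}\sum_{g\in\mathbb{S}_n}\phi(g)\rho(g)$. Put $$\tau_{\mathbb{S}_{n-2}}(\rho)=\frac{1}{|\mathbb{S}_{n-2}|}\sum_{h\in\mathbb{S}_{n-2}}\rho(h).$$ Let $D_n=\{(),(n-1,n),(n-2,n-1),(n-2,n),(n-2,n-1,n),(n-2,n,n-1),(n-3,n-1)(n-2,n)\}$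 (cycle notation; e.g. $(1,4,3)$ maps $1\to4\to3\to1$), a transversal of the double cosets $\mathbb{S}_{n-2}\backslash\mathbb{S}_n/\mathbb{S}_{n-2}$. For $f=(f_1,\dots,f_d):\mathbb{S}_n\to\mathbb{C}^d$, $g_1\in\mathbb{S}_n$ and $i_1,i_2\in\{1,\dots,d\}$ let $$\hat r_{(i_1,i_2)}(g_1,\rho)=\frac{1}{|\mathbb{S}_n|}\sum_{\tilde g\in\mathbb{S}_n}f_{i_1}(\tilde g)\,f_{i_2}(\tilde g g_1)\,\rho(\tilde g).$$ The reduced Multi-Orbit Skew Spectrum of $f$ is the collection, over all $g_1\in D_n$ and $\rho\in\Lambda_n$, of the block-diagonal matrices $$\bigoplus_{(i_1,i_2,i_3)\in\{1,\dots,d\}^3}\bigl(\hat r_{(i_1,i_2)}(g_1,\rho)\,\tau_{\mathbb{S}_{n-2}}(\rho)\bigr)^\dagger\,\hat f_{i_3}(\rho).$$ Operations are arithmetic operations on scalars; $O(\cdot)$ is with respect to $n,d$. *)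

theory Defs
  imports Complex_Main "HOL-Library.FuncSet" "HOL-Algebra.Sym_Groups" "HOL-Algebra.Left_Coset"
begin

subsection \<open>Matrices over finite index sets\<close>

text \<open>A matrix is a function of a row index and a column index. Only its values on the
  index set in question are meaningful.\<close>

type_synonym ('i, 'a) matrix = "'i \<Rightarrow> 'i \<Rightarrow> 'a"

definition mat_mult :: "'i set \<Rightarrow> ('i, 'a::comm_ring_1) matrix \<Rightarrow> ('i, 'a) matrix \<Rightarrow> ('i, 'a) matrix"
  where "mat_mult S A B = (\<lambda>i j. \<Sum>k\<in>S. A i k * B k j)"

definition adjoint_mat :: "('i, complex) matrix \<Rightarrow> ('i, complex) matrix"
  where "adjoint_mat A = (\<lambda>i j. cnj (A j i))"

definition direct_sum :: "('b \<Rightarrow> ('i, complex) matrix) \<Rightarrow> ('b \<times> 'i, complex) matrix"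
  where "direct_sum A = (\<lambda>(b, i) (c, j). if b = c then A b i j else 0)"

subsection \<open>Young's orthogonal representation\<close>

text \<open>A partition is the list of its parts, largest first. Rows and columns of its diagram are
  counted from 0; the entries of a tableau are \<open>1, \<dots>, n\<close>. A tableau takes the value 0
  outside the diagram, so that equality of tableaux is equality of functions.\<close>

type_synonym tableau = "nat \<times> nat \<Rightarrow> nat"

definition cells :: "nat list \<Rightarrow> (nat \<times> nat) set"
  where "cells \<mu> = {(i, j). i < length \<mu> \<and> j < \<mu> ! i}"

definition standard_tableaux :: "nat list \<Rightarrow> tableau set"
  where "standard_tableaux \<mu> = {T. bij_betw T (cells \<mu>) {1..sum_list \<mu>} \<and>
     (\<forall>c. c \<notin> cells \<mu> \<longrightarrow> T c = 0) \<and>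
     (\<forall>i j. (i, Suc j) \<in> cells \<mu> \<longrightarrow> T (i, j) < T (i, Suc j)) \<and>
     (\<forall>i j. (Suc i, j) \<in> cells \<mu> \<longrightarrow> T (i, j) < T (Suc i, j))}"

text \<open>Column minus row of the cell containing the entry \<open>k\<close>.\<close>

definition content :: "nat list \<Rightarrow> tableau \<Rightarrow> nat \<Rightarrow> int"
  where "content \<mu> T k = (case inv_into (cells \<mu>) T k of (i, j) \<Rightarrow> int j - int i)"

text \<open>The matrix of the adjacent transposition \<open>(k, k+1)\<close> in Young's orthogonal form.\<close>

definition young_gen :: "nat list \<Rightarrow> nat \<Rightarrow> (tableau, real) matrix"
  where "young_gen \<mu> k = (\<lambda>T U.
     let r = real_of_int (content \<mu> U (Suc k) - content \<mu> U k) in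
     if T = U then 1 / r
     else if T = transpose k (Suc k) \<circ> U then sqrt (1 - 1 / r\<^sup>2)
     else 0)"

text \<open>A word \<open>[k\<^sub>1, \<dots>, k\<^sub>l]\<close> stands for the product \<open>(k\<^sub>1, k\<^sub>1+1) \<cdots> (k\<^sub>l, k\<^sub>l+1)\<close>
  of adjacent transpositions.\<close>

definition word_perm :: "nat list \<Rightarrow> nat \<Rightarrow> nat"
  where "word_perm ks = foldr (\<lambda>k p. transpose k (Suc k) \<circ> p) ks id"

definition word_mat :: "nat list \<Rightarrow> nat list \<Rightarrow> (tableau, real) matrix"
  where "word_mat \<mu> ks = foldr (\<lambda>k. mat_mult (standard_tableaux \<mu>) (young_gen \<mu> k)) ks
     (\<lambda>T U. if T = U then 1 else 0)"

text \<open>A reduced word for a permutation \<open>g\<close> of \<open>{1..n}\<close>, following the chain of symmetric groups: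
  with \<open>a = g n\<close>, the cycle \<open>(a, a+1) \<cdots> (n-1, n)\<close> represents the coset of \<open>g\<close> modulo the
  stabiliser of \<open>n\<close>.\<close>

primrec reduced_word :: "nat \<Rightarrow> (nat \<Rightarrow> nat) \<Rightarrow> nat list"
  where
    "reduced_word 0 g = []"
  | "reduced_word (Suc m) g =
      (let ks = [g (Suc m)..<Suc m] in ks @ reduced_word m (word_perm (rev ks) \<circ> g))"

text \<open>By Young's theorem the matrices \<^const>\<open>young_gen\<close> satisfy the Coxeter relations, so the
  choice of the word is immaterial and the following is the representation of the symmetric
  group that sends \<open>(k, k+1)\<close> to \<open>young_gen \<mu> k\<close>.\<close>

definition young_orth :: "nat list \<Rightarrow> (nat \<Rightarrow> nat) \<Rightarrow> (tableau, real) matrix"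
  where "young_orth \<mu> g = word_mat \<mu> (reduced_word (sum_list \<mu>) g)"

lemma finite_cells: "finite (cells \<mu>)"
proof -
  have "cells \<mu> = (SIGMA i:{..<length \<mu>}. {..<\<mu> ! i})"
    by (auto simp: cells_def)
  then show ?thesis by simp
qed

lemma finite_standard_tableaux: "finite (standard_tableaux \<mu>)"
proof (rule finite_subset)
  show "standard_tableaux \<mu> \<subseteq>
      {T. \<forall>c. (c \<in> cells \<mu> \<longrightarrow> T c \<in> {1..sum_list \<mu>}) \<and> (c \<notin> cells \<mu> \<longrightarrow> T c = 0)}"
    unfolding standard_tableaux_def by (auto simp: bij_betw_def)
  show "finite {T. \<forall>c. (c \<in> cells \<mu> \<longrightarrow> T c \<in> {1..sum_list \<mu>}) \<and> (c \<notin> cells \<mu> \<longrightarrow> T c = 0)}"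
    by (rule finite_set_of_finite_funs) (simp_all add: finite_cells)
qed

lemma word_perm_Nil [simp]: "word_perm [] = id"
  and word_perm_Cons [simp]: "word_perm (k # ks) = transpose k (Suc k) \<circ> word_perm ks"
  by (simp_all add: word_perm_def)

lemma word_perm_append: "word_perm (ks @ ls) = word_perm ks \<circ> word_perm ls"
  by (induction ks) (simp_all add: comp_assoc)

lemma word_perm_rev: "word_perm ks \<circ> word_perm (rev ks) = id"
proof (induction ks)
  case (Cons k ks)
  have "word_perm (k # ks) \<circ> word_perm (rev (k # ks))
      = transpose k (Suc k) \<circ> (word_perm ks \<circ> word_perm (rev ks)) \<circ> transpose k (Suc k)"
    by (simp add: word_perm_append comp_assoc)
  also have "\<dots> = id"
    by (simp only: Cons.IH comp_id transpose_comp_involutory)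
  finally show ?case .
qed simp

lemma word_perm_upt: "a \<le> b \<Longrightarrow> word_perm [a..<b] b = a"
  by (induction "b - a" arbitrary: a) (simp_all add: upt_rec)

lemma word_perm_permutes: "set ks \<subseteq> {1..<n} \<Longrightarrow> word_perm ks permutes {1..n}"
proof (induction ks)
  case (Cons k ks)
  then have "transpose k (Suc k) permutes {1..n}"
    by (intro permutes_swap_id) auto
  with Cons show ?case
    unfolding word_perm_Cons by (intro permutes_compose) auto
qed (simp add: permutes_id)

lemma word_perm_reduced_word: "g permutes {1..n} \<Longrightarrow> word_perm (reduced_word n g) = g"
proof (induction n arbitrary: g)
  case (Suc m)
  define ks where "ks = [g (Suc m)..<Suc m]"
  define h where "h = word_perm (rev ks) \<circ> g"
  have a: "g (Suc m) \<in> {1..Suc m}"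
    using permutes_in_image[OF Suc.prems, of "Suc m"] by simp
  have inv: "word_perm (rev ks) \<circ> word_perm ks = id"
    using word_perm_rev[of "rev ks"] by simp
  have "h permutes {1..Suc m}"
    unfolding h_def
    by (rule permutes_compose[OF Suc.prems word_perm_permutes]) (use a in \<open>auto simp: ks_def\<close>)
  moreover have "h (Suc m) = Suc m"
  proof -
    have "word_perm ks (Suc m) = g (Suc m)"
      unfolding ks_def by (rule word_perm_upt) (use a in simp)
    then show ?thesis using inv by (simp add: h_def fun_eq_iff) metis
  qed
  ultimately have "h permutes {1..m}"
    by (smt (verit, best) atLeastAtMost_iff le_Suc_eq permutes_superset Diff_iff)
  then have "word_perm (reduced_word m h) = h"
    by (rule Suc.IH)
  then have "word_perm (reduced_word (Suc m) g) = word_perm ks \<circ> h"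
    by (simp add: word_perm_append h_def ks_def Let_def del: upt_Suc)
  also have "\<dots> = g"
    by (simp add: h_def comp_assoc[symmetric] word_perm_rev)
  finally show ?case .
qed simp

subsection \<open>The reduced Multi-Orbit Skew Spectrum\<close>

text \<open>The group of permutations of \<open>{1..n}\<close> that fix \<open>n-1\<close> and \<open>n\<close> is
  \<open>carrier (sym_group (n - 2))\<close>: its elements are functions on all of \<open>nat\<close>.\<close>

definition irreps :: "nat \<Rightarrow> nat list set"
  where "irreps n = {[n], [n - 1, 1], [n - 2, 2], [n - 2, 1, 1]}"

definition double_coset_reps :: "nat \<Rightarrow> (nat \<Rightarrow> nat) set"
  where "double_coset_reps n =
     {id,
      cycle_of_list [n - 1, n],
      cycle_of_list [n - 2, n - 1],
      cycle_of_list [n - 2, n],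
      cycle_of_list [n - 2, n - 1, n],
      cycle_of_list [n - 2, n, n - 1],
      cycle_of_list [n - 3, n - 1] \<circ> cycle_of_list [n - 2, n]}"

definition fourier :: "nat \<Rightarrow> ((nat \<Rightarrow> nat) \<Rightarrow> complex) \<Rightarrow> nat list \<Rightarrow> (tableau, complex) matrix"
  where "fourier n \<phi> \<mu> = (\<lambda>T U.
     1 / of_nat (order (sym_group n)) *
     (\<Sum>g\<in>carrier (sym_group n). \<phi> g * of_real (young_orth \<mu> g T U)))"

definition stab_average :: "nat \<Rightarrow> nat list \<Rightarrow> (tableau, complex) matrix"
  where "stab_average n \<mu> = (\<lambda>T U.
     1 / of_nat (order (sym_group (n - 2))) *
     (\<Sum>h\<in>carrier (sym_group (n - 2)). of_real (young_orth \<mu> h T U)))"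

definition r_hat ::
    "nat \<Rightarrow> (nat \<Rightarrow> (nat \<Rightarrow> nat) \<Rightarrow> complex) \<Rightarrow> nat \<Rightarrow> nat \<Rightarrow> (nat \<Rightarrow> nat) \<Rightarrow> nat list
      \<Rightarrow> (tableau, complex) matrix"
  where "r_hat n f i1 i2 g1 \<mu> = fourier n (\<lambda>g. f i1 g * f i2 (g \<circ> g1)) \<mu>"

definition skew_spectrum ::
    "nat \<Rightarrow> (nat \<Rightarrow> (nat \<Rightarrow> nat) \<Rightarrow> complex) \<Rightarrow> (nat \<Rightarrow> nat) \<Rightarrow> nat list
      \<Rightarrow> ((nat \<times> nat \<times> nat) \<times> tableau, complex) matrix"
  where "skew_spectrum n f g1 \<mu> = direct_sum (\<lambda>(i1, i2, i3).
     let S = standard_tableaux \<mu> in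
     mat_mult S (adjoint_mat (mat_mult S (r_hat n f i1 i2 g1 \<mu>) (stab_average n \<mu>)))
       (fourier n (f i3) \<mu>))"

definition block_indices ::
    "nat \<Rightarrow> nat list \<Rightarrow> ((nat \<times> nat \<times> nat) \<times> tableau) set"
  where "block_indices d \<mu> = ({1..d} \<times> {1..d} \<times> {1..d}) \<times> standard_tableaux \<mu>"

type_synonym entry_index =
  "(nat \<Rightarrow> nat) \<times> nat list \<times> ((nat \<times> nat \<times> nat) \<times> tableau) \<times> ((nat \<times> nat \<times> nat) \<times> tableau)"

text \<open>The positions of all scalar entries of the whole collection of matrices.\<close>

definition entry_indices :: "nat \<Rightarrow> nat \<Rightarrow> entry_index set"
  where "entry_indices n d =
     (SIGMA g1:double_coset_reps n. SIGMA \<mu>:irreps n. block_indices d \<mu> \<times> block_indices d \<mu>)"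

definition spectrum_entry ::
    "nat \<Rightarrow> (nat \<Rightarrow> (nat \<Rightarrow> nat) \<Rightarrow> complex) \<Rightarrow> entry_index \<Rightarrow> complex"
  where "spectrum_entry n f = (\<lambda>(g1, \<mu>, p, q). skew_spectrum n f g1 \<mu> p q)"

lemma finite_entry_indices: "finite (entry_indices n d)"
  by (simp add: entry_indices_def double_coset_reps_def irreps_def block_indices_def
      finite_standard_tableaux)

subsection \<open>Functions on the cosets and their tables of values\<close>

definition right_invariant :: "nat \<Rightarrow> nat \<Rightarrow> (nat \<Rightarrow> (nat \<Rightarrow> nat) \<Rightarrow> complex) \<Rightarrow> bool"
  where "right_invariant n d f \<longleftrightarrow>
     (\<forall>i\<in>{1..d}. \<forall>\<sigma>\<in>carrier (sym_group n). \<forall>h\<in>carrier (sym_group (n - 2)). f i (\<sigma> \<circ> h) = f i \<sigma>)"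

definition table_positions :: "nat \<Rightarrow> nat \<Rightarrow> (nat \<times> (nat \<Rightarrow> nat) set) set"
  where "table_positions n d =
     {1..d} \<times> (lcosets\<^bsub>sym_group n\<^esub> (carrier (sym_group (n - 2))))"

text \<open>For a right invariant \<open>f\<close> and a left coset \<open>K\<close> this is the common value of \<open>f i\<close> on \<open>K\<close>.\<close>

definition coset_table ::
    "(nat \<Rightarrow> (nat \<Rightarrow> nat) \<Rightarrow> complex) \<Rightarrow> nat \<times> (nat \<Rightarrow> nat) set \<Rightarrow> complex"
  where "coset_table f = (\<lambda>(i, K). the_elem (f i ` K))"

subsection \<open>Counting arithmetic operations\<close>

text \<open>Straight-line programs over the complex numbers. Each instruction is one arithmetic
  operation, and its result goes to the next free register; inputs and scalar constants
  (which may depend on \<open>n\<close> and \<open>d\<close> but not on the inputs) are available at no cost. Complex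
  conjugation, which the adjoint requires, counts as an operation. There is no division
  instruction; dividing by a nonzero constant is a multiplication by its inverse.\<close>

datatype 'x operand = Input 'x | Const complex | Reg nat

datatype 'x instr =
    Add "'x operand" "'x operand"
  | Sub "'x operand" "'x operand"
  | Mul "'x operand" "'x operand"
  | Conj "'x operand"

fun operand_value :: "('x \<Rightarrow> complex) \<Rightarrow> complex list \<Rightarrow> 'x operand \<Rightarrow> complex"
  where
    "operand_value env rs (Input x) = env x"
  | "operand_value env rs (Const c) = c"
  | "operand_value env rs (Reg k) = rs ! k"

fun instr_value :: "('x \<Rightarrow> complex) \<Rightarrow> complex list \<Rightarrow> 'x instr \<Rightarrow> complex"
  where
    "instr_value env rs (Add a b) = operand_value env rs a + operand_value env rs b"
  | "instr_value env rs (Sub a b) = operand_value env rs a - operand_value env rs b"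
  | "instr_value env rs (Mul a b) = operand_value env rs a * operand_value env rs b"
  | "instr_value env rs (Conj a) = cnj (operand_value env rs a)"

definition run_program :: "('x \<Rightarrow> complex) \<Rightarrow> 'x instr list \<Rightarrow> complex list"
  where "run_program env P = foldl (\<lambda>rs c. rs @ [instr_value env rs c]) [] P"

text \<open>Only inputs from \<open>X\<close> and only registers that have already been filled may be read.\<close>

fun wf_operand :: "'x set \<Rightarrow> nat \<Rightarrow> 'x operand \<Rightarrow> bool"
  where
    "wf_operand X m (Input x) \<longleftrightarrow> x \<in> X"
  | "wf_operand X m (Const c) \<longleftrightarrow> True"
  | "wf_operand X m (Reg k) \<longleftrightarrow> k < m"

fun wf_instr :: "'x set \<Rightarrow> nat \<Rightarrow> 'x instr \<Rightarrow> bool"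
  where
    "wf_instr X m (Add a b) \<longleftrightarrow> wf_operand X m a \<and> wf_operand X m b"
  | "wf_instr X m (Sub a b) \<longleftrightarrow> wf_operand X m a \<and> wf_operand X m b"
  | "wf_instr X m (Mul a b) \<longleftrightarrow> wf_operand X m a \<and> wf_operand X m b"
  | "wf_instr X m (Conj a) \<longleftrightarrow> wf_operand X m a"

definition wf_program :: "'x set \<Rightarrow> 'x instr list \<Rightarrow> bool"
  where "wf_program X P \<longleftrightarrow> (\<forall>m<length P. wf_instr X m (P ! m))"

text \<open>The map \<open>out\<close> tells for every entry of the spectrum where its value is found after the run.\<close>

definition computes_spectrum ::
    "nat \<Rightarrow> nat \<Rightarrow> (nat \<times> (nat \<Rightarrow> nat) set) instr list
      \<Rightarrow> (entry_index \<Rightarrow> (nat \<times> (nat \<Rightarrow> nat) set) operand) \<Rightarrow> bool"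
  where "computes_spectrum n d P out \<longleftrightarrow>
     wf_program (table_positions n d) P \<and>
     (\<forall>e\<in>entry_indices n d. wf_operand (table_positions n d) (length P) (out e)) \<and>
     (\<forall>f. right_invariant n d f \<longrightarrow>
        (\<forall>e\<in>entry_indices n d.
           operand_value (coset_table f) (run_program (coset_table f) P) (out e)
             = spectrum_entry n f e))"

end

theory Submission
  imports Defs
begin

text \<open>The reduced word of a permutation of the form \<open>\<sigma> h\<close>, with \<open>\<sigma>\<close> the canonical representative of
  a coset of \<open>S\<^sub>n\<^sub>-\<^sub>2\<close> and \<open>h\<close> in \<open>S\<^sub>n\<^sub>-\<^sub>2\<close>, is the word of \<open>\<sigma>\<close> followed by the word of \<open>h\<close>. Hence
  every average over \<open>S\<^sub>n\<^sub>-\<^sub>2\<close> can be evaluated on words, and the Coxeter relations are never needed.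
  The average over \<open>S\<^sub>n\<^sub>-\<^sub>2\<close> is the coordinate projection to the tableaux that have \<open>1, \<dots>, n-2\<close> in
  the first row. There are \<open>1, 2, 1, 1\<close> of these for the four shapes, which leaves at most
  \<open>7 \<cdot> (1 + 4 + 1 + 1) = 49\<close> entries for every triple \<open>(i\<^sub>1, i\<^sub>2, i\<^sub>3)\<close>.

  For the operation count, let \<open>\<kappa>\<^sub>K(a, b)\<close> be an entry in row \<open>K\<close> of the matrix of the representative
  \<open>(a, a+1) \<cdots> (n-1, n) (b, b+1) \<cdots> (n-2, n-1)\<close>. The matrix of \<open>(a, a+1)\<close> fixes row \<open>K\<close> if \<open>a\<close> and
  \<open>a+1\<close> are in the first row of \<open>K\<close>. At most two cells are outside the first row, so
  \<open>\<kappa>\<^sub>K(a, b)\<close> changes with \<open>a\<close> at most at four places, and summation by parts expresses the Fourier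
  coefficient \<open>\<Sum>\<^sub>a\<^sub>,\<^sub>b \<phi>(a, b) \<kappa>\<^sub>K(a, b)\<close> by \<open>O(n)\<close> of the \<open>n\<^sup>2\<close> partial sums of \<open>\<phi>\<close> in \<open>a\<close>. A Fourier
  transform at all \<open>O(n\<^sup>2)\<close> tableaux \<open>K\<close> therefore takes \<open>O(n\<^sup>3)\<close> operations, and \<open>O(d\<^sup>2)\<close> of them are
  needed. The final matrix products take \<open>O(n\<^sup>2)\<close> operations for each of the \<open>49 d\<^sup>3\<close> entries.\<close>

subsection \<open>Tableaux and words\<close>

definition lower_cells :: "nat list \<Rightarrow> (nat \<times> nat) set"
  where "lower_cells \<mu> = {c \<in> cells \<mu>. fst c \<noteq> 0}"

text \<open>For a standard tableau of size at least \<open>m\<close> this says that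
  \<open>1, ..., m\<close> stand in the first row. It is encoded through the cells below that row
  because the four shapes have at most two of them.\<close>

definition first_row_upto :: "nat list \<Rightarrow> nat \<Rightarrow> tableau \<Rightarrow> bool"
  where "first_row_upto \<mu> m U \<longleftrightarrow> (\<forall>c\<in>lower_cells \<mu>. m < U c)"

lemma first_row_upto_lower: "first_row_upto \<mu> m U \<Longrightarrow> c \<in> cells \<mu> \<Longrightarrow> fst c \<noteq> 0 \<Longrightarrow> m < U c"
  unfolding first_row_upto_def lower_cells_def by blast

context
  fixes \<mu> :: "nat list" and U :: tableau
  assumes U: "U \<in> standard_tableaux \<mu>"
begin

lemma tableau_bij: "bij_betw U (cells \<mu>) {1..sum_list \<mu>}"
  using U by (simp add: standard_tableaux_def)

lemma tableau_inj: "c \<in> cells \<mu> \<Longrightarrow> c' \<in> cells \<mu> \<Longrightarrow> U c = U c' \<Longrightarrow> c = c'"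
  using tableau_bij by (auto simp: bij_betw_def inj_on_def)

lemma tableau_range: "c \<in> cells \<mu> \<Longrightarrow> U c \<in> {1..sum_list \<mu>}"
  using tableau_bij by (auto simp: bij_betw_def)

lemma tableau_outside: "c \<notin> cells \<mu> \<Longrightarrow> U c = 0"
  using U unfolding standard_tableaux_def by blast

lemma tableau_cell:
  assumes "k \<in> {1..sum_list \<mu>}"
  obtains c where "c \<in> cells \<mu>" "U c = k"
  using assms tableau_bij unfolding bij_betw_def by (metis imageE)

lemma tableau_row_Suc: "(i, Suc j) \<in> cells \<mu> \<Longrightarrow> U (i, j) < U (i, Suc j)"
  using U by (simp add: standard_tableaux_def)

lemma tableau_col_Suc: "(Suc i, j) \<in> cells \<mu> \<Longrightarrow> U (i, j) < U (Suc i, j)"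
  using U by (simp add: standard_tableaux_def)

lemma tableau_row_less: "j < j' \<Longrightarrow> (i, j') \<in> cells \<mu> \<Longrightarrow> U (i, j) < U (i, j')"
proof (induction j')
  case (Suc j')
  then have "(i, j') \<in> cells \<mu>" by (auto simp: cells_def)
  then show ?case
    using Suc tableau_row_Suc[of i j'] by (cases "j = j'") auto
qed simp

lemma content_cell: "(i, j) \<in> cells \<mu> \<Longrightarrow> content \<mu> U (U (i, j)) = int j - int i"
  using tableau_bij by (simp add: content_def bij_betw_def)

text \<open>These entries fill the row from the left without gaps. If \<open>k\<close> stood further
  right than column \<open>k - 1\<close>, the cell in that column would hold some smaller entry
  \<open>l\<close>, but by induction \<open>l\<close> already occupies column
  \<open>l - 1\<close>.\<close>

lemma first_row_upto_entry:
  assumes good: "first_row_upto \<mu> m U" and m: "m \<le> sum_list \<mu>"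
  shows "1 \<le> k \<Longrightarrow> k \<le> m \<Longrightarrow> (0, k - 1) \<in> cells \<mu> \<and> U (0, k - 1) = k"
proof (induction k rule: less_induct)
  case (less k)
  obtain c where c: "c \<in> cells \<mu>" "U c = k"
    using tableau_cell[of k] less.prems m by auto
  then have "fst c = 0"
    using first_row_upto_lower[OF good c(1)] less.prems by linarith
  then obtain j where j: "c = (0, j)" by (cases c) auto
  have IH: "(0, k' - 1) \<in> cells \<mu>" "U (0, k' - 1) = k'" if "1 \<le> k'" "k' < k" for k'
    using less.IH[of k'] less.prems that by auto
  have "j \<ge> k - 1"
  proof (rule ccontr)
    assume "\<not> j \<ge> k - 1"
    then have "U (0, j) = Suc j" "Suc j < k" using IH[of "Suc j"] by auto
    with c j show False by simp
  qed
  moreover have "\<not> j > k - 1"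
  proof
    assume jk: "j > k - 1"
    then have cell: "(0, k - 1) \<in> cells \<mu>" using c j by (auto simp: cells_def)
    have lt: "U (0, k - 1) < k" using tableau_row_less[OF jk, of 0] c j by simp
    have ge: "1 \<le> U (0, k - 1)" using tableau_range[OF cell] by simp
    have "U (0, U (0, k - 1) - 1) = U (0, k - 1)" "(0, U (0, k - 1) - 1) \<in> cells \<mu>"
      using IH[OF ge lt] by auto
    then have "U (0, k - 1) - 1 = k - 1"
      using tableau_inj[of "(0, U (0, k - 1) - 1)" "(0, k - 1)"] cell by simp
    with lt ge show False by linarith
  qed
  ultimately have "j = k - 1" by simp
  with c j show ?case by simp
qed

text \<open>A cell between those of \<open>k\<close> and \<open>k + 1\<close> would need an entry
  strictly between the two numbers.\<close>

lemma first_row_adjacent: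
  assumes k: "1 \<le> k" "k < sum_list \<mu>"
    and row: "\<And>c. c \<in> lower_cells \<mu> \<Longrightarrow> U c \<noteq> k \<and> U c \<noteq> Suc k"
  obtains j where "(0, Suc j) \<in> cells \<mu>" "U (0, j) = k" "U (0, Suc j) = Suc k"
proof -
  obtain c where c: "c \<in> cells \<mu>" "U c = k" using tableau_cell[of k] k by auto
  obtain c' where c': "c' \<in> cells \<mu>" "U c' = Suc k" using tableau_cell[of "Suc k"] k by auto
  have "fst c = 0" using c row[of c] by (auto simp: lower_cells_def)
  then obtain j where j: "c = (0, j)" by (cases c) auto
  have "fst c' = 0" using c' row[of c'] by (auto simp: lower_cells_def)
  then obtain j' where j': "c' = (0, j')" by (cases c') auto
  have "j < j'"
    using tableau_row_less[of j' j 0] c c' j j' by (cases j j' rule: linorder_cases) auto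
  have "\<not> Suc j < j'"
  proof
    assume lt: "Suc j < j'"
    then have "(0, Suc j) \<in> cells \<mu>" using c' j' by (auto simp: cells_def)
    then have "k < U (0, Suc j)" using tableau_row_Suc c j by fastforce
    moreover have "U (0, Suc j) < Suc k" using tableau_row_less[OF lt, of 0] c' j' by simp
    ultimately show False by simp
  qed
  with \<open>j < j'\<close> have "j' = Suc j" by simp
  with c c' j j' that show thesis by auto
qed

end

section \<open>Generators that act trivially on a tableau\<close>

text \<open>Neighbours in a row have content difference 1, so the diagonal entry is 1. Swapping them
  would destroy the increase along the row, so no other standard tableau is linked. The choice of
  \<open>M\<close> makes the lemma serve both for a row and for a column of the matrix.\<close>

lemma young_gen_adjacent:
  assumes K: "K \<in> standard_tableaux \<mu>" and L: "L \<in> standard_tableaux \<mu>"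
    and M: "M = K \<or> M = L" and c: "(0, Suc j) \<in> cells \<mu>" "M (0, j) = k" "M (0, Suc j) = Suc k"
  shows "young_gen \<mu> k K L = (if K = L then 1 else 0)"
proof (cases "K = L")
  case True
  have "(0, j) \<in> cells \<mu>" using c by (auto simp: cells_def)
  then have "content \<mu> L k = int j" "content \<mu> L (Suc k) = int j + 1"
    using content_cell[OF L, of 0 j] content_cell[OF L, of 0 "Suc j"] c M True by auto
  with True show ?thesis by (simp add: young_gen_def)
next
  case False
  have "K \<noteq> transpose k (Suc k) \<circ> L"
  proof
    assume *: "K = transpose k (Suc k) \<circ> L"
    have "K (0, j) < K (0, Suc j)" "L (0, j) < L (0, Suc j)"
      using tableau_row_Suc[OF K c(1)] tableau_row_Suc[OF L c(1)] by auto
    with c M show False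
    proof (elim disjE)
      assume "M = K"
      have "L (0, j) = transpose k (Suc k) (K (0, j))" "L (0, Suc j) = transpose k (Suc k) (K (0, Suc j))"
        by (simp_all add: *)
      with c \<open>M = K\<close> \<open>L (0, j) < L (0, Suc j)\<close> show False by simp
    qed (simp add: *)
  qed
  with False show ?thesis by (simp add: young_gen_def)
qed

text \<open>The lower entries determine which numbers remain for the first row, and these must
  increase. At the first column where the rows differ, the smaller entry has to occur in the other
  tableau too: not below, not further right, and not further left by injectivity.\<close>

lemma tableau_eqI:
  assumes K: "K \<in> standard_tableaux \<mu>" and L: "L \<in> standard_tableaux \<mu>"
    and eq: "\<And>c. c \<in> lower_cells \<mu> \<Longrightarrow> K c = L c"
  shows "K = L"
proof -
  \<comment> \<open>Stated for arbitrary \<open>K'\<close> and \<open>L'\<close> because it is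
    applied in both orders.\<close>
  have not_less: "\<not> K' (0, j) < L' (0, j)"
    if K': "K' \<in> standard_tableaux \<mu>" and L': "L' \<in> standard_tableaux \<mu>"
      and eq': "\<And>c. c \<in> lower_cells \<mu> \<Longrightarrow> K' c = L' c"
      and IH: "\<And>j'. j' < j \<Longrightarrow> K' (0, j') = L' (0, j')" and j: "(0, j) \<in> cells \<mu>" for K' L' j
  proof
    assume less: "K' (0, j) < L' (0, j)"
    obtain c where c: "c \<in> cells \<mu>" "L' c = K' (0, j)"
      using tableau_cell[OF L' tableau_range[OF K' j]] by auto
    have "fst c = 0"
    proof (rule ccontr)
      assume "fst c \<noteq> 0"
      then have "K' c = K' (0, j)" using eq' c by (auto simp: lower_cells_def)
      then show False using tableau_inj[OF K' c(1) j] \<open>fst c \<noteq> 0\<close> by auto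
    qed
    then obtain j' where j': "c = (0, j')" by (cases c) auto
    have "j' < j"
      using tableau_row_less[OF L', of j j' 0] less c j' by (cases j' j rule: linorder_cases) auto
    then show False using IH[of j'] tableau_inj[OF K', of "(0, j')" "(0, j)"] c j j' by auto
  qed
  have row: "(0, j) \<in> cells \<mu> \<Longrightarrow> K (0, j) = L (0, j)" for j
  proof (induction j rule: less_induct)
    case (less j)
    then have "K (0, j') = L (0, j')" if "j' < j" for j'
      using that by (force simp: cells_def)
    then show ?case
      using not_less[OF K L eq _ less.prems] not_less[OF L K eq[symmetric] _ less.prems]
      by (metis linorder_less_linear)
  qed
  show ?thesis
  proof
    fix c show "K c = L c"
    proof (cases "c \<in> cells \<mu>")
      case True
      then show ?thesis using row eq by (cases c; cases "fst c = 0") (auto simp: lower_cells_def)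
    qed (simp add: tableau_outside[OF K] tableau_outside[OF L])
  qed
qed

section \<open>Matrices of words in the adjacent transpositions\<close>

lemma word_mat_Nil: "word_mat \<mu> [] = (\<lambda>T U. if T = U then 1 else 0)"
  by (simp add: word_mat_def)

lemma word_mat_Cons: "word_mat \<mu> (k # ks) K U
    = (\<Sum>L\<in>standard_tableaux \<mu>. young_gen \<mu> k K L * word_mat \<mu> ks L U)"
  by (simp add: word_mat_def mat_mult_def)

lemma word_mat_append:
  "K \<in> standard_tableaux \<mu> \<Longrightarrow> word_mat \<mu> (ks @ ls) K U
    = (\<Sum>L\<in>standard_tableaux \<mu>. word_mat \<mu> ks K L * word_mat \<mu> ls L U)"
proof (induction ks arbitrary: K)
  case Nil
  then show ?case
    using finite_standard_tableaux by (simp add: word_mat_Nil of_bool_def[symmetric] if_distrib[of "\<lambda>x. x * _"] cong: if_cong)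
next
  case (Cons k ks)
  have "word_mat \<mu> ((k # ks) @ ls) K U = (\<Sum>M\<in>standard_tableaux \<mu>. young_gen \<mu> k K M *
      (\<Sum>L\<in>standard_tableaux \<mu>. word_mat \<mu> ks M L * word_mat \<mu> ls L U))"
    using Cons.IH by (simp add: word_mat_Cons)
  also have "\<dots> = (\<Sum>L\<in>standard_tableaux \<mu>. word_mat \<mu> (k # ks) K L * word_mat \<mu> ls L U)"
    unfolding word_mat_Cons sum_distrib_left sum_distrib_right
    by (subst sum.swap) (simp add: mult.assoc)
  finally show ?case .
qed

lemma word_mat_single:
  "U \<in> standard_tableaux \<mu> \<Longrightarrow> word_mat \<mu> [k] K U = young_gen \<mu> k K U"
  using finite_standard_tableaux
  by (simp add: word_mat_Cons word_mat_Nil if_distrib[of "\<lambda>x. _ * x"] cong: if_cong)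

lemma word_mat_Cons_adjacent:
  assumes K: "K \<in> standard_tableaux \<mu>"
    and c: "(0, Suc j) \<in> cells \<mu>" "K (0, j) = k" "K (0, Suc j) = Suc k"
  shows "word_mat \<mu> (k # ks) K U = word_mat \<mu> ks K U"
proof -
  have "word_mat \<mu> (k # ks) K U
      = (\<Sum>L\<in>standard_tableaux \<mu>. if K = L then word_mat \<mu> ks L U else 0)"
    unfolding word_mat_Cons
    by (rule sum.cong) (auto simp: young_gen_adjacent[OF K _ disjI1[OF refl] c])
  then show ?thesis using K finite_standard_tableaux by simp
qed

text \<open>The counterpart for columns: consecutive entries up to \<open>m\<close> are neighbours
  in the first row of \<open>T\<close>, so column \<open>T\<close> of each of these generators is a
  unit vector.\<close>

lemma word_mat_first_row:
  assumes T: "T \<in> standard_tableaux \<mu>" "first_row_upto \<mu> m T" "m \<le> sum_list \<mu>"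
    and ks: "set ks \<subseteq> {1..<m}"
  shows "L \<in> standard_tableaux \<mu> \<Longrightarrow> word_mat \<mu> ks L T = (if L = T then 1 else 0)"
  using ks
proof (induction ks arbitrary: L)
  case (Cons k ks)
  have k: "1 \<le> k" "k < m" using Cons.prems by auto
  have c: "(0, Suc (k - 1)) \<in> cells \<mu>" "T (0, k - 1) = k" "T (0, Suc (k - 1)) = Suc k"
    using first_row_upto_entry[OF T, of k] first_row_upto_entry[OF T, of "Suc k"] k by auto
  have "word_mat \<mu> (k # ks) L T
      = (\<Sum>M\<in>standard_tableaux \<mu>. young_gen \<mu> k L M * (if M = T then 1 else 0))"
    unfolding word_mat_Cons using Cons by (intro sum.cong) auto
  also have "\<dots> = young_gen \<mu> k L T"
    using T(1) finite_standard_tableaux by (simp add: if_distrib[of "\<lambda>x. _ * x"] cong: if_cong)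
  also have "\<dots> = (if L = T then 1 else 0)"
    by (rule young_gen_adjacent[OF Cons.prems(1) T(1) disjI2[OF refl] c])
  finally show ?case .
qed (simp add: word_mat_Nil)

text \<open>The entry \<open>m + 1\<close> is the smallest one below the first row. Its upper and
  left neighbours hold smaller entries and hence lie in the first row, which leaves only the corner
  of the second row.\<close>

lemma first_row_upto_next_cell:
  assumes U: "U \<in> standard_tableaux \<mu>" "first_row_upto \<mu> m U" "\<not> first_row_upto \<mu> (Suc m) U"
    and decr: "sorted_wrt (\<ge>) \<mu>"
  shows "(1, 0) \<in> cells \<mu> \<and> U (1, 0) = Suc m"
proof -
  obtain c where c: "c \<in> cells \<mu>" "fst c \<noteq> 0" "\<not> Suc m < U c" "m < U c"
    using U(2,3) by (auto simp: first_row_upto_def lower_cells_def)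
  then obtain i j where ij: "c = (Suc i, j)" by (metis prod.collapse not0_implies_Suc)
  have Uc: "U (Suc i, j) = Suc m" using c ij by simp
  have small: "fst c' = 0" if "c' \<in> cells \<mu>" "U c' < Suc m" for c'
    using first_row_upto_lower[OF U(2) that(1)] that(2) by linarith
  have "\<mu> ! Suc i \<le> \<mu> ! i" using c ij sorted_wrt_nth_less[OF decr, of i "Suc i"] by (auto simp: cells_def)
  then have "(i, j) \<in> cells \<mu>" using c ij by (auto simp: cells_def)
  then have "i = 0" using small[of "(i, j)"] tableau_col_Suc[OF U(1), of i j] c ij Uc by auto
  moreover have "j = 0"
  proof (cases j)
    case (Suc j')
    have "(Suc i, j') \<in> cells \<mu>" using c ij Suc by (auto simp: cells_def)
    then show ?thesis
      using small[of "(Suc i, j')"] tableau_row_Suc[OF U(1), of "Suc i" j'] c ij Suc Uc by auto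
  qed
  ultimately show ?thesis using c ij Uc by simp
qed

text \<open>With \<open>s\<^sub>k\<close> the matrix of \<open>(k, k+1)\<close>, the sums \<open>E\<^sub>m = \<Sum>\<^sub>a s\<^sub>a \<cdots> s\<^sub>m\<^sub>-\<^sub>1\<close> satisfy
  \<open>E\<^sub>m\<^sub>+\<^sub>1 = 1 + E\<^sub>m s\<^sub>m\<close>. Here \<open>s\<^sub>m\<close> maps \<open>U\<close> to a combination of \<open>U\<close>, with coefficient \<open>-1/m\<close> that cancels
  the summand \<open>1\<close> because \<open>E\<^sub>m U = m U\<close>, and of a tableau \<open>U'\<close> to which the induction hypothesis applies.\<close>

lemma sum_cycle_words_eq_0:
  assumes decr: "sorted_wrt (\<ge>) \<mu>"
  shows "U \<in> standard_tableaux \<mu> \<Longrightarrow> first_row_upto \<mu> m U \<Longrightarrow> \<not> first_row_upto \<mu> (Suc m) U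
    \<Longrightarrow> L \<in> standard_tableaux \<mu> \<Longrightarrow> 1 \<le> m \<Longrightarrow> (\<Sum>a = 1..Suc m. word_mat \<mu> [a..<Suc m] L U) = 0"
proof (induction m arbitrary: U)
  case (Suc m)
  define S where "S = standard_tableaux \<mu>"
  let ?m = "Suc m"
  define U' where "U' = transpose ?m (Suc ?m) \<circ> U"
  note U = Suc.prems(1-3)
  have L: "L \<in> S" using Suc.prems(4) by (simp add: S_def)
  have fin: "finite S" by (simp add: S_def finite_standard_tableaux)
  have cell: "(1, 0) \<in> cells \<mu>" "U (1, 0) = Suc ?m"
    using first_row_upto_next_cell[OF U decr] by auto
  have m_le: "?m \<le> sum_list \<mu>" using tableau_range[OF U(1) cell(1)] cell(2) by simp
  have "(0, m) \<in> cells \<mu>" "U (0, m) = ?m"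
    using first_row_upto_entry[OF U(1,2) m_le, of ?m] by auto
  \<comment> \<open>The content difference is \<open>-1 - m\<close>, the negative of
    \<open>?m\<close>; hence the diagonal coefficient \<open>-1 / ?m\<close> below.\<close>
  then have c: "content \<mu> U (Suc ?m) = -1" "content \<mu> U ?m = int m"
    using content_cell[OF U(1), of 0 m] content_cell[OF U(1) cell(1)[unfolded One_nat_def]] cell
    by auto
  define w where "w = sqrt (1 - 1 / (real (Suc m))\<^sup>2)"
  have gen: "young_gen \<mu> ?m M U = (if M = U then - 1 / real ?m else if M = U' then w else 0)" for M
    unfolding young_gen_def Let_def c U'_def w_def
    by (simp add: power2_eq_square algebra_simps divide_simps)
  have U'_cell: "U' (1, 0) = ?m" using cell by (simp add: U'_def)
  then have "U' \<noteq> U" using cell by auto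
  have stable: "word_mat \<mu> [a..<?m] L U = (if L = U then 1 else 0)" if "a \<in> {1..?m}" for a
    by (rule word_mat_first_row[OF U(1,2) m_le]) (use that L in \<open>auto simp: S_def simp del: upt_Suc\<close>)
  define E where "E M = (\<Sum>a = 1..?m. word_mat \<mu> [a..<?m] L M)" for M
  \<comment> \<open>Only a standard \<open>U'\<close> contributes to the sum over \<open>S\<close>.
    It has \<open>?m\<close> in the corner of the second row, so the induction hypothesis applies to
    it with \<open>m\<close>. That hypothesis requires \<open>1 \<le> m\<close>; for
    \<open>m = 0\<close> the factor \<open>w\<close> is 0.\<close>
  have zero: "w * E U' = 0" if U': "U' \<in> S"
  proof (cases "m = 0")
    case True then show ?thesis by (simp add: w_def)
  next
    case False
    have "first_row_upto \<mu> m U'"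
      unfolding first_row_upto_def
    proof
      fix c assume c: "c \<in> lower_cells \<mu>"
      then have "?m < U c" using U(2) by (auto simp: first_row_upto_def)
      then show "m < U' c" by (auto simp: U'_def transpose_def)
    qed
    moreover have "\<not> first_row_upto \<mu> ?m U'"
    proof -
      have "(1, 0) \<in> lower_cells \<mu>" using cell by (simp add: lower_cells_def)
      then show ?thesis using U'_cell by (metis first_row_upto_def less_irrefl)
    qed
    ultimately show ?thesis using Suc.IH[of U'] U' L False by (simp add: S_def E_def del: sum.cl_ivl_Suc upt_Suc)
  qed
  have "(\<Sum>a = 1..Suc ?m. word_mat \<mu> [a..<Suc ?m] L U)
      = (\<Sum>a = 1..?m. word_mat \<mu> [a..<Suc ?m] L U) + (if L = U then 1 else 0)"
    by (subst sum.cl_ivl_Suc) (simp add: word_mat_Nil del: sum.cl_ivl_Suc upt_Suc)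
  also have "(\<Sum>a = 1..?m. word_mat \<mu> [a..<Suc ?m] L U)
      = (\<Sum>a = 1..?m. \<Sum>M\<in>S. word_mat \<mu> [a..<?m] L M * young_gen \<mu> ?m M U)"
  proof (rule sum.cong[OF refl])
    fix a assume "a \<in> {1..?m}"
    then have "[a..<Suc ?m] = [a..<?m] @ [?m]" by simp
    then show "word_mat \<mu> [a..<Suc ?m] L U
        = (\<Sum>M\<in>S. word_mat \<mu> [a..<?m] L M * young_gen \<mu> ?m M U)"
      using L U(1) by (simp add: word_mat_append word_mat_single S_def del: upt_Suc)
  qed
  also have "\<dots> = (\<Sum>M\<in>S. E M * young_gen \<mu> ?m M U)"
    unfolding E_def sum_distrib_right by (rule sum.swap)
  also have "\<dots> = (\<Sum>M\<in>S. (if M = U then - E U / real ?m else 0)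
      + (if M = U' then w * E U' else 0))"
    using \<open>U' \<noteq> U\<close> by (intro sum.cong) (auto simp: gen)
  also have "\<dots> = - E U / real ?m"
    unfolding sum.distrib using fin U(1) zero by (simp add: S_def[symmetric])
  also have "E U = (if L = U then real ?m else 0)"
    using stable by (simp add: E_def del: sum.cl_ivl_Suc upt_Suc)
  finally show ?case by (simp del: sum.cl_ivl_Suc upt_Suc)
qed simp

subsection \<open>Fourier transforms on the cosets\<close>

lemma carrier_sym_group: "carrier (sym_group n) = {g. g permutes {1..n}}"
  by (simp add: sym_group_def)

lemma order_sym_group: "order (sym_group n) = fact n"
  by (simp add: order_def carrier_sym_group card_permutations)

lemma word_perm_upt_permutes: "1 \<le> a \<Longrightarrow> word_perm [a..<n] permutes {1..n}"
  by (rule word_perm_permutes) auto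

lemma word_perm_rev': "word_perm (rev ks) \<circ> word_perm ks = id"
  using word_perm_rev[of "rev ks"] by simp

text \<open>Since \<open>h\<close> fixes \<open>m + 1\<close>, the image of \<open>m + 1\<close>
  under the product is \<open>a\<close>. The recursion therefore reads off exactly this cycle and
  continues with \<open>h\<close>.\<close>

lemma reduced_word_Suc:
  assumes a: "a \<in> {1..Suc m}" and h: "h permutes {1..m}"
  shows "reduced_word (Suc m) (word_perm [a..<Suc m] \<circ> h) = [a..<Suc m] @ reduced_word m h"
proof -
  have "h (Suc m) = Suc m" using permutes_not_in[OF h] by simp
  then have "(word_perm [a..<Suc m] \<circ> h) (Suc m) = a"
    using word_perm_upt[of a "Suc m"] a by (simp del: upt_Suc)
  then show ?thesis
    using word_perm_rev'[of "[a..<Suc m]"] by (simp add: Let_def o_assoc del: upt_Suc)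
qed

text \<open>The coset decomposition modulo the stabiliser of \<open>m + 1\<close>, with
  \<open>a\<close> the image of \<open>m + 1\<close>.\<close>

lemma bij_betw_cycle_words:
  "bij_betw (\<lambda>(a, h). word_perm [a..<Suc m] \<circ> h)
     ({1..Suc m} \<times> {h. h permutes {1..m}}) {g. g permutes {1..Suc m}}"
proof (rule bij_betw_byWitness)
  let ?F = "\<lambda>(a, h). word_perm [a..<Suc m] \<circ> h"
  let ?G = "\<lambda>g. (g (Suc m), word_perm (rev [g (Suc m)..<Suc m]) \<circ> g)"
  have perm: "word_perm [a..<Suc m] \<circ> h permutes {1..Suc m}"
    if "a \<in> {1..Suc m}" "h permutes {1..m}" for a h
    using that word_perm_upt_permutes[of a "Suc m"]
    by (intro permutes_compose) (auto intro: permutes_subset)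
  show "?F ` ({1..Suc m} \<times> {h. h permutes {1..m}}) \<subseteq> {g. g permutes {1..Suc m}}"
    using perm by auto
  have val: "(word_perm [a..<Suc m] \<circ> h) (Suc m) = a"
    if "a \<in> {1..Suc m}" "h permutes {1..m}" for a h
    using word_perm_upt[of a "Suc m"] permutes_not_in[OF that(2), of "Suc m"] that(1)
    by (simp del: upt_Suc)
  show "\<forall>x\<in>{1..Suc m} \<times> {h. h permutes {1..m}}. ?G (?F x) = x"
  proof
    fix x :: "nat \<times> (nat \<Rightarrow> nat)" assume "x \<in> {1..Suc m} \<times> {h. h permutes {1..m}}"
    then obtain a h where x: "x = (a, h)" and a: "a \<in> {1..Suc m}" and h: "h permutes {1..m}" by auto
    have "word_perm (rev [a..<Suc m]) \<circ> (word_perm [a..<Suc m] \<circ> h) = h"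
      by (simp only: o_assoc word_perm_rev' id_o)
    then show "?G (?F x) = x"
      by (simp only: x prod.case val[OF a h])
  qed
  show "\<forall>g\<in>{g. g permutes {1..Suc m}}. ?F (?G g) = g"
    by (simp add: o_assoc word_perm_rev del: upt_Suc)
  show "?G ` {g. g permutes {1..Suc m}} \<subseteq> {1..Suc m} \<times> {h. h permutes {1..m}}"
  proof clarify
    fix g :: "nat \<Rightarrow> nat" assume g: "g permutes {1..Suc m}"
    define ks where "ks = [g (Suc m)..<Suc m]"
    define h where "h = word_perm (rev ks) \<circ> g"
    have a: "g (Suc m) \<in> {1..Suc m}" using permutes_in_image[OF g, of "Suc m"] by simp
    have h: "h permutes {1..Suc m}"
      unfolding h_def
      by (rule permutes_compose[OF g word_perm_permutes]) (use a in \<open>auto simp: ks_def\<close>)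
    have "word_perm ks (Suc m) = g (Suc m)"
      unfolding ks_def by (rule word_perm_upt) (use a in simp)
    then have "h (Suc m) = Suc m"
      using word_perm_rev'[of ks] by (simp add: h_def fun_eq_iff) metis
    have "h permutes {1..m}"
    proof (rule permutes_superset[OF h])
      fix x assume "x \<in> {1..Suc m} - {1..m}"
      then have "x = Suc m" by auto
      with \<open>h (Suc m) = Suc m\<close> show "h x = x" by simp
    qed
    with a show "g (Suc m) \<in> {1..Suc m} \<and>
        word_perm (rev [g (Suc m)..<Suc m]) \<circ> g \<in> {h. h permutes {1..m}}"
      by (simp add: h_def ks_def del: upt_Suc)
  qed
qed

lemma sum_sym_group_Suc:
  fixes \<Psi> :: "(nat \<Rightarrow> nat) \<Rightarrow> 'a::comm_monoid_add"
  shows "(\<Sum>g\<in>carrier (sym_group (Suc m)). \<Psi> g)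
    = (\<Sum>a = 1..Suc m. \<Sum>h\<in>carrier (sym_group m). \<Psi> (word_perm [a..<Suc m] \<circ> h))"
  unfolding carrier_sym_group sum.cartesian_product
  using sum.reindex_bij_betw[OF bij_betw_cycle_words[of m], of \<Psi>]
  by (simp add: case_prod_unfold del: upt_Suc)

lemma set_reduced_word: "h permutes {1..m} \<Longrightarrow> set (reduced_word m h) \<subseteq> {1..<m}"
proof (induction m arbitrary: h)
  case (Suc m)
  have "h \<in> (\<lambda>(a, h). word_perm [a..<Suc m] \<circ> h) ` ({1..Suc m} \<times> {h. h permutes {1..m}})"
    using bij_betw_imp_surj_on[OF bij_betw_cycle_words[of m]] Suc.prems by blast
  then obtain a h' where "a \<in> {1..Suc m}" "h' permutes {1..m}" "h = word_perm [a..<Suc m] \<circ> h'"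
    by (auto simp del: upt_Suc)
  moreover from this have "reduced_word (Suc m) h = [a..<Suc m] @ reduced_word m h'"
    by (simp only: reduced_word_Suc)
  then have "set (reduced_word (Suc m) h) = {a..<Suc m} \<union> set (reduced_word m h')"
    by (simp only: set_append set_upt)
  moreover have "set (reduced_word m h') \<subseteq> {1..<m}"
    using Suc.IH calculation by blast
  ultimately show ?case by (simp only:) auto
qed simp

lemma first_row_upto_1:
  assumes U: "U \<in> standard_tableaux \<mu>" and decr: "sorted_wrt (\<ge>) \<mu>"
  shows "first_row_upto \<mu> (Suc 0) U"
  unfolding first_row_upto_def
proof
  fix c assume "c \<in> lower_cells \<mu>"
  then obtain i j where c: "c = (Suc i, j)" "(Suc i, j) \<in> cells \<mu>"
    by (cases c) (auto simp: lower_cells_def gr0_conv_Suc)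
  have "\<mu> ! Suc i \<le> \<mu> ! i" using c sorted_wrt_nth_less[OF decr, of i "Suc i"] by (auto simp: cells_def)
  then have "(i, j) \<in> cells \<mu>" using c by (auto simp: cells_def)
  then show "Suc 0 < U c"
    using tableau_range[OF U, of "(i, j)"] tableau_col_Suc[OF U c(2)] c by auto
qed

text \<open>Up to the factor \<open>m!\<close> this is the projection onto the vectors fixed by the
  smaller group. In the induction the inner sum over \<open>h\<close> retains column
  \<open>U\<close> only if \<open>1, ..., m\<close> are in the first row; the outer sum over cycles
  then gives the factor \<open>m + 1\<close> or cancels to 0, according to where
  \<open>m + 1\<close> stands.\<close>

lemma sum_word_mat_sym_group:
  assumes decr: "sorted_wrt (\<ge>) \<mu>"
    and U: "U \<in> standard_tableaux \<mu>" and m: "m \<le> sum_list \<mu>"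
  shows "L \<in> standard_tableaux \<mu> \<Longrightarrow>
    (\<Sum>h\<in>carrier (sym_group m). word_mat \<mu> (reduced_word m h) L U)
      = (if first_row_upto \<mu> m U \<and> L = U then fact m else 0)"
  using m
proof (induction m arbitrary: L)
  case 0
  have "first_row_upto \<mu> 0 U"
    using first_row_upto_1[OF U decr] by (auto simp: first_row_upto_def)
  then show ?case by (simp add: carrier_sym_group word_mat_Nil)
next
  case (Suc m)
  let ?S = "standard_tableaux \<mu>"
  have "(\<Sum>g\<in>carrier (sym_group (Suc m)). word_mat \<mu> (reduced_word (Suc m) g) L U)
      = (\<Sum>a = 1..Suc m. \<Sum>h\<in>carrier (sym_group m). \<Sum>M\<in>?S.
          word_mat \<mu> [a..<Suc m] L M * word_mat \<mu> (reduced_word m h) M U)"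
    unfolding sum_sym_group_Suc using Suc.prems
    by (intro sum.cong)
      (auto simp: carrier_sym_group reduced_word_Suc word_mat_append simp del: upt_Suc reduced_word.simps)
  also have "\<dots> = (\<Sum>a = 1..Suc m. \<Sum>M\<in>?S. word_mat \<mu> [a..<Suc m] L M *
      (\<Sum>h\<in>carrier (sym_group m). word_mat \<mu> (reduced_word m h) M U))"
    unfolding sum_distrib_left by (intro sum.cong refl sum.swap)
  also have "\<dots> = (\<Sum>a = 1..Suc m. \<Sum>M\<in>?S. if M = U then
      (if first_row_upto \<mu> m U then fact m * word_mat \<mu> [a..<Suc m] L U else 0) else 0)"
    using Suc by (intro sum.cong) (auto simp del: upt_Suc)
  also have "\<dots> = (\<Sum>a = 1..Suc m.
      if first_row_upto \<mu> m U then fact m * word_mat \<mu> [a..<Suc m] L U else 0)"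
    using U finite_standard_tableaux by (simp del: upt_Suc sum.cl_ivl_Suc)
  also have "\<dots> = (if first_row_upto \<mu> m U
      then fact m * (\<Sum>a = 1..Suc m. word_mat \<mu> [a..<Suc m] L U) else 0)"
    by (simp add: sum_distrib_left del: upt_Suc sum.cl_ivl_Suc)
  also have "\<dots> = (if first_row_upto \<mu> (Suc m) U \<and> L = U then fact (Suc m) else 0)"
  proof (cases "first_row_upto \<mu> (Suc m) U")
    case True
    have "word_mat \<mu> [a..<Suc m] L U = (if L = U then 1 else 0)" if "a \<in> {1..Suc m}" for a
      by (rule word_mat_first_row[OF U True Suc.prems(2)])
        (use that Suc.prems in \<open>auto simp del: upt_Suc\<close>)
    then have "(\<Sum>a = 1..Suc m. word_mat \<mu> [a..<Suc m] L U) = (if L = U then real (Suc m) else 0)"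
      by (simp del: sum.cl_ivl_Suc upt_Suc)
    moreover have "first_row_upto \<mu> m U" using True by (auto simp: first_row_upto_def)
    ultimately show ?thesis using True by (simp del: sum.cl_ivl_Suc upt_Suc)
  next
    case False
    \<comment> \<open>The entry 1 is always in the first row, so \<open>m = 0\<close> cannot occur
      here.\<close>
    then have "1 \<le> m" using first_row_upto_1[OF U decr] by (cases m) auto
    with False show ?thesis
      using sum_cycle_words_eq_0[OF decr U _ False Suc.prems(1)]
      by (simp del: sum.cl_ivl_Suc upt_Suc)
  qed
  finally show ?case .
qed

section \<open>Summation by parts\<close>

lemma abel_summation:
  fixes \<phi> k :: "nat \<Rightarrow> 'a::comm_ring_1"
  assumes n: "1 \<le> n" and B: "B \<subseteq> {1..n}" "n \<in> B"
    and const: "\<And>a. a \<in> {1..<n} - B \<Longrightarrow> k a = k (Suc a)"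
  shows "(\<Sum>a = 1..n. \<phi> a * k a)
    = (\<Sum>a\<in>B. (\<Sum>a' = 1..a. \<phi> a') * (k a - (if a = n then 0 else k (Suc a))))"
proof -
  have "(\<Sum>a = 1..m. \<phi> a * k a)
      = (\<Sum>a = 1..m. (\<Sum>a' = 1..a. \<phi> a') * (k a - k (Suc a))) + (\<Sum>a' = 1..m. \<phi> a') * k (Suc m)" for m
    by (induction m) (simp_all add: algebra_simps)
  \<comment> \<open>At \<open>n - 1\<close> the leftover term joins the summand for \<open>n\<close>
    to give the full sum times \<open>k n\<close>. Hence the value subtracted at
    \<open>a = n\<close> is 0, and \<open>B\<close> must contain \<open>n\<close>.\<close>
  from this[of "n - 1"] n
  have "(\<Sum>a = 1..n. \<phi> a * k a)
      = (\<Sum>a = 1..n. (\<Sum>a' = 1..a. \<phi> a') * (k a - (if a = n then 0 else k (Suc a))))"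
    by (cases n) (simp_all add: algebra_simps)
  also have "\<dots> = (\<Sum>a\<in>B. (\<Sum>a' = 1..a. \<phi> a') * (k a - (if a = n then 0 else k (Suc a))))"
  proof (rule sum.mono_neutral_right)
    show "\<forall>a\<in>{1..n} - B. (\<Sum>a' = 1..a. \<phi> a') * (k a - (if a = n then 0 else k (Suc a))) = 0"
    proof
      fix a assume a: "a \<in> {1..n} - B"
      then have "a \<noteq> n" using B by auto
      moreover from this have "k a = k (Suc a)" using a by (intro const) auto
      ultimately show "(\<Sum>a' = 1..a. \<phi> a') * (k a - (if a = n then 0 else k (Suc a))) = 0"
        by simp
    qed
  qed (use B in auto)
  finally show ?thesis .
qed

section \<open>Fourier coefficients in terms of coset representatives\<close>

text \<open>It sends \<open>n\<close> to \<open>a\<close> and \<open>n - 1\<close> to the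
  \<open>b\<close>-th of the remaining points. So \<open>a \<le> n\<close> and
  \<open>b \<le> n - 1\<close> enumerate the \<open>n * (n - 1)\<close> left cosets.\<close>

definition coset_rep :: "nat \<Rightarrow> nat \<Rightarrow> nat \<Rightarrow> nat \<Rightarrow> nat"
  where "coset_rep n a b = word_perm ([a..<n] @ [b..<n - 1])"

definition coset_mat :: "nat list \<Rightarrow> nat \<Rightarrow> nat \<Rightarrow> (tableau, real) matrix"
  where "coset_mat \<mu> a b = word_mat \<mu> ([a..<sum_list \<mu>] @ [b..<sum_list \<mu> - 1])"

lemma coset_rep_permutes:
  "1 \<le> a \<Longrightarrow> 1 \<le> b \<Longrightarrow> coset_rep n a b permutes {1..n}"
  unfolding coset_rep_def by (rule word_perm_permutes) auto

lemma sum_sym_group_cosets: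
  fixes \<Psi> :: "(nat \<Rightarrow> nat) \<Rightarrow> 'a::comm_monoid_add"
  assumes "2 \<le> n"
  shows "(\<Sum>g\<in>carrier (sym_group n). \<Psi> g)
    = (\<Sum>a = 1..n. \<Sum>b = 1..n - 1. \<Sum>h\<in>carrier (sym_group (n - 2)). \<Psi> (coset_rep n a b \<circ> h))"
proof -
  obtain m where n: "n = Suc (Suc m)" using assms by (metis Suc_le_D numeral_2_eq_2 Suc_le_mono)
  show ?thesis
    unfolding n sum_sym_group_Suc
    by (simp add: coset_rep_def word_perm_append o_assoc del: upt_Suc sum.cl_ivl_Suc)
qed

lemma reduced_word_coset_rep:
  assumes "2 \<le> n" "a \<in> {1..n}" "b \<in> {1..n - 1}" "h \<in> carrier (sym_group (n - 2))"
  shows "reduced_word n (coset_rep n a b \<circ> h) = ([a..<n] @ [b..<n - 1]) @ reduced_word (n - 2) h"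
proof -
  obtain m where n: "n = Suc (Suc m)" using assms by (metis Suc_le_D numeral_2_eq_2 Suc_le_mono)
  have h: "h permutes {1..m}" using assms n by (simp add: carrier_sym_group)
  have "word_perm [b..<Suc m] \<circ> h permutes {1..Suc m}"
    using assms n h word_perm_upt_permutes[of b "Suc m"]
    by (intro permutes_compose) (auto intro: permutes_subset)
  then show ?thesis
    using assms h unfolding n
    by (simp add: coset_rep_def word_perm_append comp_assoc reduced_word_Suc del: upt_Suc reduced_word.simps)
qed

lemma sum_young_orth_cosets:
  fixes \<phi> :: "(nat \<Rightarrow> nat) \<Rightarrow> complex"
  assumes n: "2 \<le> n" "sum_list \<mu> = n" and K: "K \<in> standard_tableaux \<mu>"
  shows "(\<Sum>g\<in>carrier (sym_group n). \<phi> g * of_real (young_orth \<mu> g K U))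
    = (\<Sum>a = 1..n. \<Sum>b = 1..n - 1. \<Sum>h\<in>carrier (sym_group (n - 2)). \<phi> (coset_rep n a b \<circ> h) *
        of_real (\<Sum>L\<in>standard_tableaux \<mu>. coset_mat \<mu> a b K L * word_mat \<mu> (reduced_word (n - 2) h) L U))"
  unfolding sum_sym_group_cosets[OF n(1)]
proof (intro sum.cong refl)
  fix a b h assume "a \<in> {1..n}" "b \<in> {1..n - 1}" "h \<in> carrier (sym_group (n - 2))"
  then have "young_orth \<mu> (coset_rep n a b \<circ> h) K U = (\<Sum>L\<in>standard_tableaux \<mu>.
      coset_mat \<mu> a b K L * word_mat \<mu> (reduced_word (n - 2) h) L U)"
    unfolding young_orth_def n(2) coset_mat_def
    by (subst reduced_word_coset_rep[OF n(1)]) (simp_all add: word_mat_append[OF K, of "_ @ _"] del: append_assoc)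
  then show "\<phi> (coset_rep n a b \<circ> h) * complex_of_real (young_orth \<mu> (coset_rep n a b \<circ> h) K U)
      = \<phi> (coset_rep n a b \<circ> h) * of_real (\<Sum>L\<in>standard_tableaux \<mu>.
          coset_mat \<mu> a b K L * word_mat \<mu> (reduced_word (n - 2) h) L U)"
    by simp
qed

text \<open>Words of the stabiliser fix column \<open>U\<close>, so only the values of
  \<open>\<phi>\<close> are summed over \<open>h\<close>. No invariance of \<open>\<phi>\<close>
  enters, which lets the formula apply to the products inside \<open>r_hat\<close>.\<close>

lemma fourier_first_row:
  assumes n: "2 \<le> n" "sum_list \<mu> = n"
    and K: "K \<in> standard_tableaux \<mu>" and U: "U \<in> standard_tableaux \<mu>" "first_row_upto \<mu> (n - 2) U"
  shows "fourier n \<phi> \<mu> K U = 1 / fact n * (\<Sum>a = 1..n. \<Sum>b = 1..n - 1.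
    (\<Sum>h\<in>carrier (sym_group (n - 2)). \<phi> (coset_rep n a b \<circ> h)) * of_real (coset_mat \<mu> a b K U))"
proof -
  have "(\<Sum>L\<in>standard_tableaux \<mu>. coset_mat \<mu> a b K L * word_mat \<mu> (reduced_word (n - 2) h) L U)
      = coset_mat \<mu> a b K U" if h: "h \<in> carrier (sym_group (n - 2))" for a b h
  proof -
    have "word_mat \<mu> (reduced_word (n - 2) h) L U = (if L = U then 1 else 0)"
      if "L \<in> standard_tableaux \<mu>" for L
      by (rule word_mat_first_row[OF U _ _ that])
        (use n h set_reduced_word in \<open>auto simp: carrier_sym_group\<close>)
    then show ?thesis
      using finite_standard_tableaux U(1) by (simp add: if_distrib[of "\<lambda>x. _ * x"] cong: if_cong)
  qed
  then show ?thesis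
    unfolding fourier_def sum_young_orth_cosets[OF n K] order_sym_group
    by (simp add: sum_distrib_right)
qed

text \<open>Invariance takes \<open>\<phi>\<close> out of the sum over \<open>h\<close>; what
  remains is a sum of matrices over the stabiliser, whose column \<open>U\<close> vanishes.\<close>

lemma fourier_not_first_row:
  assumes n: "2 \<le> n" "sum_list \<mu> = n" and decr: "sorted_wrt (\<ge>) \<mu>"
    and inv: "\<And>\<sigma> h. \<sigma> \<in> carrier (sym_group n) \<Longrightarrow> h \<in> carrier (sym_group (n - 2)) \<Longrightarrow> \<phi> (\<sigma> \<circ> h) = \<phi> \<sigma>"
    and K: "K \<in> standard_tableaux \<mu>" and U: "U \<in> standard_tableaux \<mu>" "\<not> first_row_upto \<mu> (n - 2) U"
  shows "fourier n \<phi> \<mu> K U = 0"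
proof -
  let ?H = "carrier (sym_group (n - 2))"
  have "(\<Sum>h\<in>?H. \<phi> (coset_rep n a b \<circ> h) * of_real (\<Sum>L\<in>standard_tableaux \<mu>.
        coset_mat \<mu> a b K L * word_mat \<mu> (reduced_word (n - 2) h) L U)) = 0" (is "?l = 0")
    if ab: "a \<in> {1..n}" "b \<in> {1..n - 1}" for a b
  proof -
    have "?l = (\<Sum>h\<in>?H. \<phi> (coset_rep n a b) * of_real (\<Sum>L\<in>standard_tableaux \<mu>.
        coset_mat \<mu> a b K L * word_mat \<mu> (reduced_word (n - 2) h) L U))"
      using ab coset_rep_permutes[of a b n] by (intro sum.cong refl) (subst inv, simp_all add: carrier_sym_group)
    also have "\<dots> = \<phi> (coset_rep n a b) * of_real (\<Sum>h\<in>?H. \<Sum>L\<in>standard_tableaux \<mu>.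
        coset_mat \<mu> a b K L * word_mat \<mu> (reduced_word (n - 2) h) L U)"
      by (simp add: sum_distrib_left)
    also have "\<dots> = \<phi> (coset_rep n a b) * of_real (\<Sum>L\<in>standard_tableaux \<mu>.
        coset_mat \<mu> a b K L * (\<Sum>h\<in>?H. word_mat \<mu> (reduced_word (n - 2) h) L U))"
      unfolding sum_distrib_left by (subst sum.swap) (rule refl)
    also have "\<dots> = 0"
      using sum_word_mat_sym_group[OF decr U(1), of "n - 2"] U(2) n by simp
    finally show ?thesis .
  qed
  then show ?thesis
    unfolding fourier_def sum_young_orth_cosets[OF n K] by simp
qed

lemma stab_average_eq:
  assumes n: "2 \<le> n" "sum_list \<mu> = n" and decr: "sorted_wrt (\<ge>) \<mu>"
    and L: "L \<in> standard_tableaux \<mu>" and U: "U \<in> standard_tableaux \<mu>"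
  shows "stab_average n \<mu> L U = (if L = U \<and> first_row_upto \<mu> (n - 2) U then 1 else 0)"
proof -
  have "young_orth \<mu> h L U = word_mat \<mu> (reduced_word (n - 2) h) L U"
    if h: "h \<in> carrier (sym_group (n - 2))" for h
  proof -
    \<comment> \<open>The trivial coset: for it both cycle words are empty, so \<open>h\<close> has
      the same reduced word in the large group as in the stabiliser.\<close>
    have "coset_rep n n (n - 1) = id" by (simp add: coset_rep_def)
    then have "reduced_word n h = reduced_word (n - 2) h"
      using reduced_word_coset_rep[OF n(1) _ _ h, of n "n - 1"] n(1) by simp
    then show ?thesis by (simp add: young_orth_def n(2))
  qed
  then have "(\<Sum>h\<in>carrier (sym_group (n - 2)). complex_of_real (young_orth \<mu> h L U))
      = of_real (\<Sum>h\<in>carrier (sym_group (n - 2)). word_mat \<mu> (reduced_word (n - 2) h) L U)"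
    by simp
  also have "\<dots> = (if L = U \<and> first_row_upto \<mu> (n - 2) U then fact (n - 2) else 0)"
    using sum_word_mat_sym_group[OF decr U _ L, of "n - 2"] n by simp
  finally show ?thesis by (simp add: stab_average_def order_sym_group)
qed

text \<open>The row condition on \<open>T\<close> comes from the projection
  \<open>stab_average\<close>, that on \<open>U\<close> from the right invariance of
  \<open>f i3\<close>.\<close>

lemma spectrum_block:
  assumes n: "2 \<le> n" "sum_list \<mu> = n" and decr: "sorted_wrt (\<ge>) \<mu>"
    and inv: "right_invariant n d f" and i3: "i3 \<in> {1..d}"
    and T: "T \<in> standard_tableaux \<mu>" and U: "U \<in> standard_tableaux \<mu>"
  shows "skew_spectrum n f g1 \<mu> ((i1, i2, i3), T) ((i1, i2, i3), U)
    = (if first_row_upto \<mu> (n - 2) T \<and> first_row_upto \<mu> (n - 2) U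
       then \<Sum>K\<in>standard_tableaux \<mu>. cnj (r_hat n f i1 i2 g1 \<mu> K T) * fourier n (f i3) \<mu> K U else 0)"
proof -
  let ?S = "standard_tableaux \<mu>"
  have r: "mat_mult ?S (r_hat n f i1 i2 g1 \<mu>) (stab_average n \<mu>) K T
      = (if first_row_upto \<mu> (n - 2) T then r_hat n f i1 i2 g1 \<mu> K T else 0)" for K
  proof -
    have "mat_mult ?S (r_hat n f i1 i2 g1 \<mu>) (stab_average n \<mu>) K T = (\<Sum>L\<in>?S. if L = T then
        (if first_row_upto \<mu> (n - 2) T then r_hat n f i1 i2 g1 \<mu> K T else 0) else 0)"
      unfolding mat_mult_def
    proof (rule sum.cong[OF refl])
      fix L assume "L \<in> ?S"
      note eq = stab_average_eq[OF n decr this T]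
      show "r_hat n f i1 i2 g1 \<mu> K L * stab_average n \<mu> L T = (if L = T then
        (if first_row_upto \<mu> (n - 2) T then r_hat n f i1 i2 g1 \<mu> K T else 0) else 0)"
        unfolding eq by simp
    qed
    also have "\<dots> = (if first_row_upto \<mu> (n - 2) T then r_hat n f i1 i2 g1 \<mu> K T else 0)"
      using T finite_standard_tableaux by (subst sum.delta) simp_all
    finally show ?thesis .
  qed
  have zero: "fourier n (f i3) \<mu> K U = 0" if "\<not> first_row_upto \<mu> (n - 2) U" "K \<in> ?S" for K
  proof (rule fourier_not_first_row[OF n decr _ that(2) U that(1)])
    show "f i3 (\<sigma> \<circ> h) = f i3 \<sigma>"
      if "\<sigma> \<in> carrier (sym_group n)" "h \<in> carrier (sym_group (n - 2))" for \<sigma> h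
      using inv i3 that unfolding right_invariant_def by blast
  qed
  have "skew_spectrum n f g1 \<mu> ((i1, i2, i3), T) ((i1, i2, i3), U)
      = (\<Sum>K\<in>?S. cnj (mat_mult ?S (r_hat n f i1 i2 g1 \<mu>) (stab_average n \<mu>) K T) * fourier n (f i3) \<mu> K U)"
    unfolding skew_spectrum_def direct_sum_def Let_def adjoint_mat_def
    by (simp, subst mat_mult_def, rule refl)
  also have "\<dots> = (\<Sum>K\<in>?S. if first_row_upto \<mu> (n - 2) T \<and> first_row_upto \<mu> (n - 2) U
       then cnj (r_hat n f i1 i2 g1 \<mu> K T) * fourier n (f i3) \<mu> K U else 0)"
    by (rule sum.cong[OF refl]) (simp add: r zero)
  also have "\<dots> = (if first_row_upto \<mu> (n - 2) T \<and> first_row_upto \<mu> (n - 2) U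
       then \<Sum>K\<in>?S. cnj (r_hat n f i1 i2 g1 \<mu> K T) * fourier n (f i3) \<mu> K U else 0)"
    by (cases "first_row_upto \<mu> (n - 2) T"; cases "first_row_upto \<mu> (n - 2) U") simp_all
  finally show ?thesis .
qed

subsection \<open>The support of the spectrum\<close>

lemma lower_cells_irreps:
  assumes "4 \<le> n"
  shows "lower_cells [n] = {}" "lower_cells [n - 1, 1] = {(1, 0)}"
    "lower_cells [n - 2, 2] = {(1, 0), (1, 1)}" "lower_cells [n - 2, 1, 1] = {(1, 0), (2, 0)}"
  using assms
  by (auto simp: lower_cells_def cells_def nth_Cons less_Suc_eq numeral_2_eq_2 split: nat.splits)

lemma irreps_shape:
  assumes "4 \<le> n" "\<mu> \<in> irreps n"
  shows "sum_list \<mu> = n" "sorted_wrt (\<ge>) \<mu>" "\<exists>c1 c2. lower_cells \<mu> \<subseteq> {c1, c2}"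
proof -
  show "sum_list \<mu> = n" "sorted_wrt (\<ge>) \<mu>" using assms by (auto simp: irreps_def)
  show "\<exists>c1 c2. lower_cells \<mu> \<subseteq> {c1, c2}"
    using assms(2) unfolding irreps_def
    by (elim insertE emptyE) (use lower_cells_irreps[OF assms(1)] in blast)+
qed

lemma irreps_distinct:
  assumes "4 \<le> (n::nat)"
  shows "distinct [[n], [n - 1, 1], [n - 2, 2], [n - 2, 1, 1]]"
  using assms by auto

lemma tableau_le: "U \<in> standard_tableaux \<mu> \<Longrightarrow> U c \<le> sum_list \<mu>"
  using tableau_range[of U \<mu> c] tableau_outside[of U \<mu> c] by (cases "c \<in> cells \<mu>") auto

text \<open>A tableau is determined by its values at \<open>c1\<close> and \<open>c2\<close>. These
  cells may lie outside the diagram, where the value is 0, so each coordinate ranges over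
  \<open>sum_list \<mu> + 1\<close> numbers.\<close>

lemma card_standard_tableaux_le:
  assumes c: "lower_cells \<mu> \<subseteq> {c1, c2}"
  shows "card (standard_tableaux \<mu>) \<le> (Suc (sum_list \<mu>))\<^sup>2"
proof -
  have "inj_on (\<lambda>U. (U c1, U c2)) (standard_tableaux \<mu>)"
  proof (rule inj_onI)
    fix K L assume K: "K \<in> standard_tableaux \<mu>" and L: "L \<in> standard_tableaux \<mu>"
      and "(K c1, K c2) = (L c1, L c2)"
    with c show "K = L" by (intro tableau_eqI[OF K L]) auto
  qed
  moreover have "(\<lambda>U. (U c1, U c2)) ` standard_tableaux \<mu> \<subseteq> {..sum_list \<mu>} \<times> {..sum_list \<mu>}"
    by (auto simp: tableau_le)
  ultimately have "card (standard_tableaux \<mu>) \<le> card ({..sum_list \<mu>} \<times> {..sum_list \<mu>})"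
    by (rule card_inj_on_le) simp
  then show ?thesis by (simp add: power2_eq_square)
qed

definition first_row_tableaux :: "nat \<Rightarrow> nat list \<Rightarrow> tableau set"
  where "first_row_tableaux n \<mu> = {U \<in> standard_tableaux \<mu>. first_row_upto \<mu> (n - 2) U}"

lemma finite_first_row_tableaux: "finite (first_row_tableaux n \<mu>)"
  by (simp add: first_row_tableaux_def finite_standard_tableaux)

lemma card_first_row_tableaux_le_1:
  assumes "\<And>U c. U \<in> first_row_tableaux n \<mu> \<Longrightarrow> c \<in> lower_cells \<mu> \<Longrightarrow> U c = e c"
  shows "card (first_row_tableaux n \<mu>) \<le> 1"
proof -
  have "K = L" if "K \<in> first_row_tableaux n \<mu>" "L \<in> first_row_tableaux n \<mu>" for K L
    using that assms[OF that(1)] assms[OF that(2)] tableau_eqI[of K \<mu> L] by (auto simp: first_row_tableaux_def)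
  then show ?thesis using card_le_Suc0_iff_eq[OF finite_first_row_tableaux] by auto
qed

text \<open>The cells below the first row can hold only \<open>n - 1\<close> and \<open>n\<close>. A
  single cell leaves two choices; two cells are neighbours in a row or column, so their order is
  forced.\<close>

lemma card_first_row_tableaux:
  assumes n: "4 \<le> n"
  shows "card (first_row_tableaux n [n]) \<le> 1" "card (first_row_tableaux n [n - 1, 1]) \<le> 2"
    "card (first_row_tableaux n [n - 2, 2]) \<le> 1" "card (first_row_tableaux n [n - 2, 1, 1]) \<le> 1"
proof -
  show "card (first_row_tableaux n [n]) \<le> 1"
    by (rule card_first_row_tableaux_le_1) (simp add: lower_cells_irreps[OF n])
  let ?\<mu> = "[n - 1, 1]"
  have "inj_on (\<lambda>U. U (1, 0)) (first_row_tableaux n ?\<mu>)"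
  proof (rule inj_onI)
    fix K L assume KL: "K \<in> first_row_tableaux n ?\<mu>" "L \<in> first_row_tableaux n ?\<mu>"
      and "K (1, 0) = L (1, 0)"
    then have "K c = L c" if "c \<in> lower_cells ?\<mu>" for c
      using that lower_cells_irreps(2)[OF n] by simp
    with KL show "K = L" unfolding first_row_tableaux_def by (blast intro: tableau_eqI)
  qed
  moreover have "(\<lambda>U. U (1, 0)) ` first_row_tableaux n ?\<mu> \<subseteq> {n - 1, n}"
  proof (rule image_subsetI)
    fix U assume U: "U \<in> first_row_tableaux n ?\<mu>"
    then have "first_row_upto ?\<mu> (n - 2) U" "U (1, 0) \<le> n"
      using tableau_le[of U ?\<mu> "(1, 0)"] n by (simp_all add: first_row_tableaux_def)
    then have "n - 2 < U (1, 0)" "U (1, 0) \<le> n"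
      unfolding first_row_upto_def lower_cells_irreps(2)[OF n] by auto
    then have "U (1, 0) = n - 1 \<or> U (1, 0) = n" by linarith
    then show "U (1, 0) \<in> {n - 1, n}" by blast
  qed
  ultimately have "card (first_row_tableaux n ?\<mu>) \<le> card {n - 1, n}"
    by (rule card_inj_on_le) simp
  also have "\<dots> \<le> 2" by (simp add: card_insert_if)
  finally show "card (first_row_tableaux n [n - 1, 1]) \<le> 2" .
  have two: "card (first_row_tableaux n \<mu>) \<le> 1"
    if \<mu>: "\<mu> \<in> irreps n" and low: "lower_cells \<mu> = {(1, 0), c}" and ne: "c \<noteq> (1, 0)"
      and less: "\<And>U. U \<in> standard_tableaux \<mu> \<Longrightarrow> U (1, 0) < U c" for \<mu> c
  proof (rule card_first_row_tableaux_le_1)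
    fix U c' assume U: "U \<in> first_row_tableaux n \<mu>" and c': "c' \<in> lower_cells \<mu>"
    have "n - 2 < U (1, 0)" "U (1, 0) < U c" "U c \<le> n"
      using U low less[of U] tableau_le[of U \<mu> c] irreps_shape(1)[OF n \<mu>]
      by (auto simp: first_row_tableaux_def first_row_upto_def)
    then have "U (1, 0) = n - 1" "U c = n" by linarith+
    then show "U c' = (if c' = c then n else n - 1)" using low c' ne by auto
  qed
  show "card (first_row_tableaux n [n - 2, 2]) \<le> 1"
  proof (rule two[OF _ lower_cells_irreps(3)[OF n]])
    show "U (1, 0) < U (1, 1)" if "U \<in> standard_tableaux [n - 2, 2]" for U
      using tableau_row_Suc[OF that, of 1 0] by (simp add: cells_def)
  qed (simp_all add: irreps_def)
  show "card (first_row_tableaux n [n - 2, 1, 1]) \<le> 1"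
  proof (rule two[OF _ lower_cells_irreps(4)[OF n]])
    show "U (1, 0) < U (2, 0)" if "U \<in> standard_tableaux [n - 2, 1, 1]" for U
      using tableau_col_Suc[OF that, of 1 0] by (simp add: cells_def numeral_2_eq_2)
  qed (simp_all add: irreps_def)
qed

lemma sum_card_first_row_tableaux:
  assumes n: "4 \<le> n"
  shows "(\<Sum>\<mu>\<in>irreps n. (card (first_row_tableaux n \<mu>))\<^sup>2) \<le> 7"
proof -
  have "irreps n = set [[n], [n - 1, 1], [n - 2, 2], [n - 2, 1, 1]]" by (simp add: irreps_def)
  then have "(\<Sum>\<mu>\<in>irreps n. (card (first_row_tableaux n \<mu>))\<^sup>2)
    = (\<Sum>\<mu>\<leftarrow>[[n], [n - 1, 1], [n - 2, 2], [n - 2, 1, 1]]. (card (first_row_tableaux n \<mu>))\<^sup>2)"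
    using sum_list_distinct_conv_sum_set[OF irreps_distinct[OF n]] by metis
  also have "\<dots> \<le> 1\<^sup>2 + (2\<^sup>2 + (1\<^sup>2 + (1\<^sup>2 + 0)))"
    using card_first_row_tableaux[OF n]
    by (simp only: list.map sum_list.Cons sum_list.Nil) (intro add_mono power_mono; simp)
  finally show ?thesis by simp
qed

lemma card_double_coset_reps: "card (double_coset_reps n) \<le> 7"
proof -
  define gs where "gs = [id, cycle_of_list [n - 1, n], cycle_of_list [n - 2, n - 1],
    cycle_of_list [n - 2, n], cycle_of_list [n - 2, n - 1, n], cycle_of_list [n - 2, n, n - 1],
    cycle_of_list [n - 3, n - 1] \<circ> cycle_of_list [n - 2, n]]"
  have "double_coset_reps n = set gs" by (simp add: double_coset_reps_def gs_def)
  then have "card (double_coset_reps n) \<le> length gs" by (simp only: card_length)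
  also have "length gs = 7" by (simp add: gs_def)
  finally show ?thesis .
qed

lemma double_coset_reps_permutes:
  assumes n: "4 \<le> n" and g: "g \<in> double_coset_reps n"
  shows "g permutes {1..n}"
proof -
  have perm: "cycle_of_list cs permutes {1..n}" if "set cs \<subseteq> {1..n}" for cs
    using cycle_permutes[of cs] permutes_subset that by blast
  show ?thesis
    using g unfolding double_coset_reps_def
    by (elim insertE emptyE; simp only:; intro permutes_compose perm permutes_id; use n in auto)
qed

text \<open>A triple of function indices is recorded once because the direct sum vanishes between
  different blocks; an entry position repeats it for row and column.\<close>

definition spectrum_support ::
    "nat \<Rightarrow> nat \<Rightarrow> ((nat \<Rightarrow> nat) \<times> nat list \<times> (nat \<times> nat \<times> nat) \<times> tableau \<times> tableau) set"
  where "spectrum_support n d = (SIGMA g:double_coset_reps n. SIGMA \<mu>:irreps n.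
    ({1..d} \<times> {1..d} \<times> {1..d}) \<times> first_row_tableaux n \<mu> \<times> first_row_tableaux n \<mu>)"

lemma finite_double_coset_reps: "finite (double_coset_reps n)"
  and finite_irreps: "finite (irreps n)"
  by (simp_all add: double_coset_reps_def irreps_def)

lemma finite_spectrum_support: "finite (spectrum_support n d)"
  using finite_double_coset_reps finite_irreps
  by (auto simp: spectrum_support_def finite_first_row_tableaux)

lemma card_spectrum_support:
  assumes n: "4 \<le> n"
  shows "card (spectrum_support n d) \<le> 49 * d ^ 3"
proof -
  have "card (spectrum_support n d)
      = card (double_coset_reps n) * (d ^ 3 * (\<Sum>\<mu>\<in>irreps n. (card (first_row_tableaux n \<mu>))\<^sup>2))"
    unfolding spectrum_support_def using finite_double_coset_reps finite_irreps
    by (simp add: card_SigmaI finite_first_row_tableaux card_cartesian_product power2_eq_square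
        power3_eq_cube sum_distrib_left mult.assoc)
  also have "\<dots> \<le> 7 * (d ^ 3 * 7)"
    using card_double_coset_reps sum_card_first_row_tableaux[OF n] by (intro mult_mono) auto
  finally show ?thesis by simp
qed

lemma spectrum_entry_outside_support:
  assumes n: "4 \<le> n" and inv: "right_invariant n d f" and e: "e \<in> entry_indices n d"
    and out: "e \<notin> (\<lambda>(g, \<mu>, i, T, U). (g, \<mu>, (i, T), (i, U))) ` spectrum_support n d"
  shows "spectrum_entry n f e = 0"
proof (rule ccontr)
  assume nz: "spectrum_entry n f e \<noteq> 0"
  obtain g \<mu> i1 i2 i3 T j U where e_eq: "e = (g, \<mu>, ((i1, i2, i3), T), (j, U))"
    by (metis prod.collapse)
  have mem: "g \<in> double_coset_reps n" "\<mu> \<in> irreps n" "(i1, i2, i3) \<in> {1..d} \<times> {1..d} \<times> {1..d}"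
      "T \<in> standard_tableaux \<mu>" "U \<in> standard_tableaux \<mu>"
    using e by (auto simp: e_eq entry_indices_def block_indices_def)
  have j: "j = (i1, i2, i3)"
    using nz by (auto simp: e_eq spectrum_entry_def skew_spectrum_def direct_sum_def split: if_splits)
  have "first_row_upto \<mu> (n - 2) T \<and> first_row_upto \<mu> (n - 2) U"
    using nz spectrum_block[OF _ irreps_shape(1,2)[OF n mem(2)] inv _ mem(4,5), of i3 g i1 i2] n mem(3)
    by (simp add: e_eq spectrum_entry_def j split: if_splits)
  with mem have "(g, \<mu>, (i1, i2, i3), T, U) \<in> spectrum_support n d"
    by (simp add: spectrum_support_def first_row_tableaux_def)
  with out show False by (force simp: e_eq j)
qed

lemma card_nonzero_entries:
  assumes n: "4 \<le> n" and inv: "right_invariant n d f"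
  shows "card {e \<in> entry_indices n d. spectrum_entry n f e \<noteq> 0} \<le> 49 * d ^ 3"
proof -
  have "{e \<in> entry_indices n d. spectrum_entry n f e \<noteq> 0}
      \<subseteq> (\<lambda>(g, \<mu>, i, T, U). (g, \<mu>, (i, T), (i, U))) ` spectrum_support n d"
    using spectrum_entry_outside_support[OF n inv] by blast
  then have "card {e \<in> entry_indices n d. spectrum_entry n f e \<noteq> 0} \<le> card (spectrum_support n d)"
    using finite_spectrum_support by (rule surj_card_le[rotated])
  also have "\<dots> \<le> 49 * d ^ 3" by (rule card_spectrum_support[OF n])
  finally show ?thesis .
qed

section \<open>Places where a coset matrix changes\<close>

text \<open>Besides the places where \<open>a\<close> or \<open>a + 1\<close> lies below the first
  row of \<open>K\<close>, the end point is included for the boundary term of the summation by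
  parts.\<close>

definition breaks :: "nat list \<Rightarrow> tableau \<Rightarrow> nat set"
  where "breaks \<mu> K = {a \<in> {1..sum_list \<mu>}. a = sum_list \<mu> \<or> (\<exists>c\<in>lower_cells \<mu>. K c = a \<or> K c = Suc a)}"

lemma card_breaks_le:
  assumes c: "lower_cells \<mu> \<subseteq> {c1, c2}"
  shows "card (breaks \<mu> K) \<le> 5"
proof -
  \<comment> \<open>Each of the at most two lower entries blocks its own value and the one before
    it; the end point is the fifth element.\<close>
  have "breaks \<mu> K \<subseteq> set [sum_list \<mu>, K c1, K c1 - 1, K c2, K c2 - 1]"
    using c by (force simp: breaks_def)
  then have "card (breaks \<mu> K) \<le> card (set [sum_list \<mu>, K c1, K c1 - 1, K c2, K c2 - 1])"
    by (rule card_mono[rotated]) simp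
  also have "\<dots> \<le> length [sum_list \<mu>, K c1, K c1 - 1, K c2, K c2 - 1]" by (rule card_length)
  finally show ?thesis by simp
qed

text \<open>Outside the breaks \<open>a\<close> and \<open>a + 1\<close> are neighbours in the first
  row of \<open>K\<close>, so the leading letter of the word acts trivially on row
  \<open>K\<close>.\<close>

lemma coset_mat_Suc:
  assumes K: "K \<in> standard_tableaux \<mu>" and a: "a \<in> {1..<sum_list \<mu>} - breaks \<mu> K"
  shows "coset_mat \<mu> a b K U = coset_mat \<mu> (Suc a) b K U"
proof -
  have "1 \<le> a" "a < sum_list \<mu>" using a by auto
  moreover have "U c \<noteq> a \<and> U c \<noteq> Suc a" if "c \<in> lower_cells \<mu>" "U = K" for c U
    using that a by (auto simp: breaks_def)
  ultimately obtain j where "(0, Suc j) \<in> cells \<mu>" "K (0, j) = a" "K (0, Suc j) = Suc a"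
    using first_row_adjacent[OF K, of a] by blast
  from word_mat_Cons_adjacent[OF K this] show ?thesis
    using a by (simp add: coset_mat_def upt_conv_Cons)
qed

definition coset_coeff :: "nat list \<Rightarrow> tableau \<Rightarrow> tableau \<Rightarrow> nat \<Rightarrow> nat \<Rightarrow> complex"
  where "coset_coeff \<mu> K U a b = complex_of_real (coset_mat \<mu> a b K U)
     - (if a = sum_list \<mu> then 0 else complex_of_real (coset_mat \<mu> (Suc a) b K U))"

text \<open>Summation by parts in \<open>a\<close> for each fixed \<open>b\<close>, so that only the
  partial sums at the breaks survive.\<close>

lemma sum_coset_mat:
  assumes K: "K \<in> standard_tableaux \<mu>" and n: "1 \<le> sum_list \<mu>"
  shows "(\<Sum>a = 1..sum_list \<mu>. \<Sum>b = 1..m. \<phi> a b * complex_of_real (coset_mat \<mu> a b K U))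
    = (\<Sum>(a, b)\<in>breaks \<mu> K \<times> {1..m}. coset_coeff \<mu> K U a b * (\<Sum>a' = 1..a. \<phi> a' b))"
proof -
  have "(\<Sum>a = 1..sum_list \<mu>. \<phi> a b * complex_of_real (coset_mat \<mu> a b K U))
      = (\<Sum>a\<in>breaks \<mu> K. (\<Sum>a' = 1..a. \<phi> a' b) * coset_coeff \<mu> K U a b)" for b
    unfolding coset_coeff_def
    by (rule abel_summation[OF n]) (use n coset_mat_Suc[OF K] in \<open>auto simp: breaks_def\<close>)
  then show ?thesis
    unfolding sum.cartesian_product[symmetric]
    by (subst (1 2) sum.swap) (simp add: mult.commute)
qed

subsection \<open>Averages over the stabiliser\<close>

text \<open>It takes \<open>p\<close> to \<open>x\<close> and \<open>q\<close> to \<open>y\<close>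
  when \<open>p \<noteq> q\<close> and \<open>x \<noteq> y\<close>. The inner target is
  \<open>transpose q y x\<close> because the outer transposition is applied afterwards.\<close>

definition pair_perm :: "nat \<Rightarrow> nat \<Rightarrow> nat \<Rightarrow> nat \<Rightarrow> nat \<Rightarrow> nat"
  where "pair_perm p q x y = transpose q y \<circ> transpose p (transpose q y x)"

lemma pair_perm_permutes:
  "p \<in> S \<Longrightarrow> q \<in> S \<Longrightarrow> x \<in> S \<Longrightarrow> y \<in> S \<Longrightarrow> pair_perm p q x y permutes S"
  unfolding pair_perm_def
  by (intro permutes_compose permutes_swap_id) (auto simp: transpose_def)

lemma pair_perm_apply:
  assumes "p \<noteq> q" "x \<noteq> y"
  shows "pair_perm p q x y p = x" "pair_perm p q x y q = y"
  using assms by (auto simp: pair_perm_def transpose_def)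

text \<open>Composing with a transposition shows that the sum is the same for every point
  \<open>u\<close>. Adding these equal sums over all points and exchanging the order, each
  \<open>h\<close> merely permutes the values of \<open>\<phi>\<close>.\<close>

lemma sum_sym_group_apply:
  fixes \<phi> :: "nat \<Rightarrow> complex"
  assumes u: "u \<in> {1..m}"
  shows "(\<Sum>h\<in>carrier (sym_group m). \<phi> (h u)) = fact m / of_nat m * (\<Sum>x = 1..m. \<phi> x)"
proof -
  let ?H = "{h. h permutes {1..m}}"
  have shift: "(\<Sum>h\<in>?H. \<phi> (h x)) = (\<Sum>h\<in>?H. \<phi> (h u))" if x: "x \<in> {1..m}" for x
    using sum_permutations_compose_right[OF permutes_swap_id[OF u x], of "\<lambda>h. \<phi> (h u)"] by simp
  have "of_nat m * (\<Sum>h\<in>?H. \<phi> (h u)) = (\<Sum>x = 1..m. \<Sum>h\<in>?H. \<phi> (h u))"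
    by simp
  also have "\<dots> = (\<Sum>x = 1..m. \<Sum>h\<in>?H. \<phi> (h x))"
    by (intro sum.cong refl shift[symmetric])
  also have "\<dots> = (\<Sum>h\<in>?H. \<Sum>x = 1..m. \<phi> (h x))" by (rule sum.swap)
  also have "\<dots> = (\<Sum>h\<in>?H. \<Sum>x = 1..m. \<phi> x)"
  proof (rule sum.cong[OF refl])
    fix h assume "h \<in> ?H"
    then have "bij_betw h {1..m} {1..m}" using permutes_imp_bij by blast
    then show "(\<Sum>x = 1..m. \<phi> (h x)) = (\<Sum>x = 1..m. \<phi> x)"
      by (rule sum.reindex_bij_betw)
  qed
  also have "\<dots> = fact m * (\<Sum>x = 1..m. \<phi> x)" by (simp add: card_permutations)
  finally show ?thesis using u by (simp add: carrier_sym_group field_simps)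
qed

text \<open>The same double count over ordered pairs of distinct points, with
  \<open>pair_perm\<close> supplying transitivity on them.\<close>

lemma sum_sym_group_apply2:
  fixes \<phi> :: "nat \<Rightarrow> nat \<Rightarrow> complex"
  assumes u: "u \<in> {1..m}" "v \<in> {1..m}" "u \<noteq> v"
  shows "(\<Sum>h\<in>carrier (sym_group m). \<phi> (h u) (h v))
    = fact m / of_nat (m * (m - 1)) * (\<Sum>x = 1..m. \<Sum>y\<in>{1..m} - {x}. \<phi> x y)"
proof -
  let ?H = "{h. h permutes {1..m}}"
  define P where "P = (SIGMA x:{1..m}. {1..m} - {x})"
  have shift: "(\<Sum>h\<in>?H. \<phi> (h x) (h y)) = (\<Sum>h\<in>?H. \<phi> (h u) (h v))" if "(x, y) \<in> P" for x y
  proof -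
    have "x \<noteq> y" "x \<in> {1..m}" "y \<in> {1..m}" using that by (auto simp: P_def)
    then show ?thesis
      using sum_permutations_compose_right[OF pair_perm_permutes[of u "{1..m}" v x y], of "\<lambda>h. \<phi> (h u) (h v)"]
        u pair_perm_apply[of u v x y] by simp
  qed
  have "card P = m * (m - 1)" by (simp add: P_def card_SigmaI)
  then have "of_nat (m * (m - 1)) * (\<Sum>h\<in>?H. \<phi> (h u) (h v)) = (\<Sum>p\<in>P. \<Sum>h\<in>?H. \<phi> (h u) (h v))"
    by simp
  also have "\<dots> = (\<Sum>p\<in>P. \<Sum>h\<in>?H. \<phi> (h (fst p)) (h (snd p)))"
    by (intro sum.cong refl shift[symmetric]) simp
  also have "\<dots> = (\<Sum>h\<in>?H. \<Sum>p\<in>P. \<phi> (h (fst p)) (h (snd p)))" by (rule sum.swap)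
  also have "\<dots> = (\<Sum>h\<in>?H. \<Sum>p\<in>P. \<phi> (fst p) (snd p))"
  proof (rule sum.cong[OF refl])
    fix h assume "h \<in> ?H"
    then have h: "h permutes {1..m}" by (rule CollectD)
    have h_eq: "h x = h y \<longleftrightarrow> x = y" for x y by (rule inj_eq[OF permutes_inj[OF h]])
    have h_mem: "h x \<in> {1..m} \<longleftrightarrow> x \<in> {1..m}" for x by (rule permutes_in_image[OF h])
    have "bij_betw (map_prod h h) P P"
    proof (rule bij_betwI')
      show "(map_prod h h p = map_prod h h p') = (p = p')" for p p'
        by (cases p; cases p') (simp add: h_eq)
      show "map_prod h h p \<in> P" if "p \<in> P" for p
        using that by (cases p) (simp add: P_def h_eq h_mem[unfolded One_nat_def] del: atLeastAtMost_iff)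
      show "\<exists>p\<in>P. p' = map_prod h h p" if "p' \<in> P" for p'
      proof -
        obtain x y where p': "p' = (h x, h y)"
          using permutes_surj[OF h] by (metis prod.collapse surjD)
        then have "(x, y) \<in> P"
          using that by (simp add: P_def h_eq h_mem[unfolded One_nat_def] del: atLeastAtMost_iff)
        with p' show ?thesis by force
      qed
    qed
    from sum.reindex_bij_betw[OF this, of "\<lambda>p. \<phi> (fst p) (snd p)"]
    show "(\<Sum>p\<in>P. \<phi> (h (fst p)) (h (snd p))) = (\<Sum>p\<in>P. \<phi> (fst p) (snd p))" by simp
  qed
  also have "\<dots> = fact m * (\<Sum>x = 1..m. \<Sum>y\<in>{1..m} - {x}. \<phi> x y)"
    by (simp add: card_permutations P_def sum.Sigma case_prod_unfold)
  finally have "of_nat (m * (m - 1)) * (\<Sum>h\<in>?H. \<phi> (h u) (h v))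
      = fact m * (\<Sum>x = 1..m. \<Sum>y\<in>{1..m} - {x}. \<phi> x y)" .
  moreover have "of_nat (m * (m - 1)) \<noteq> (0 :: complex)" using u by (simp only: of_nat_eq_0_iff) auto
  ultimately show ?thesis by (simp only: carrier_sym_group) (simp add: field_simps)
qed

definition pair_value :: "nat \<Rightarrow> ((nat \<Rightarrow> nat) \<Rightarrow> complex) \<Rightarrow> nat \<Rightarrow> nat \<Rightarrow> complex"
  where "pair_value n \<phi> x y = \<phi> (pair_perm (n - 1) n x y)"

text \<open>The permutations \<open>g\<close> and \<open>p\<close> agree on \<open>n - 1\<close> and
  \<open>n\<close>, so they differ by a right factor from the stabiliser. Thus a right invariant
  function depends only on the images of these two points.\<close>

lemma right_invariant_pair_value:
  assumes n: "2 \<le> n" and inv: "right_invariant n d f" and i: "i \<in> {1..d}"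
    and g: "g permutes {1..n}"
  shows "f i g = pair_value n (f i) (g (n - 1)) (g n)"
proof -
  define p where "p = pair_perm (n - 1) n (g (n - 1)) (g n)"
  have ne: "g (n - 1) \<noteq> g n" using inj_eq[OF permutes_inj[OF g]] n by simp
  have p: "p permutes {1..n}"
    unfolding p_def using n permutes_in_image[OF g] by (intro pair_perm_permutes) auto
  have pv: "p (n - 1) = g (n - 1)" "p n = g n"
    using pair_perm_apply[of "n - 1" n, OF _ ne] n by (auto simp: p_def)
  define h where "h = Hilbert_Choice.inv p \<circ> g"
  have h: "h permutes {1..n}"
    unfolding h_def by (rule permutes_compose[OF g permutes_inv[OF p]])
  have "h permutes {1..n - 2}"
  proof (rule permutes_superset[OF h])
    fix x assume "x \<in> {1..n} - {1..n - 2}"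
    then have "x = n - 1 \<or> x = n" by auto
    then show "h x = x" using pv permutes_inverses[OF p] by (metis comp_apply h_def)
  qed
  moreover have "p \<circ> h = g"
    using permutes_inverses(1)[OF p] by (simp add: h_def fun_eq_iff)
  ultimately show ?thesis
    using inv i p unfolding right_invariant_def pair_value_def p_def[symmetric]
    by (metis carrier_sym_group mem_Collect_eq)
qed

definition row_total :: "nat \<Rightarrow> ((nat \<Rightarrow> nat) \<Rightarrow> complex) \<Rightarrow> nat \<Rightarrow> complex"
  where "row_total n \<phi> x = (\<Sum>y\<in>{1..n} - {x}. pair_value n \<phi> x y)"

text \<open>If \<open>g\<close> moves both \<open>n-1\<close> and \<open>n\<close> into \<open>{1..n-2}\<close>, the sum runs over quadratically many pairs;
  the row totals make it a combination of only linearly many quantities.\<close>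

lemma sum_stabiliser:
  assumes n: "4 \<le> n" and inv: "right_invariant n d f" and i: "i \<in> {1..d}"
    and \<sigma>: "\<sigma> permutes {1..n}" and g: "g permutes {1..n}"
  defines "v \<equiv> \<lambda>x y. pair_value n (f i) (\<sigma> x) (\<sigma> y)"
  shows "(\<Sum>h\<in>carrier (sym_group (n - 2)). f i (\<sigma> \<circ> h \<circ> g)) =
    (if g (n - 1) \<le> n - 2 then
       if g n \<le> n - 2 then \<Sum>x = 1..n - 2. fact (n - 2) / of_nat ((n - 2) * (n - 3)) *
         (row_total n (f i) (\<sigma> x) - v x (n - 1) - v x n)
       else \<Sum>x = 1..n - 2. fact (n - 2) / of_nat (n - 2) * v x (g n)
     else if g n \<le> n - 2 then \<Sum>x = 1..n - 2. fact (n - 2) / of_nat (n - 2) * v (g (n - 1)) x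
     else fact (n - 2) * v (g (n - 1)) (g n))"
proof -
  let ?m = "n - 2"
  let ?H = "carrier (sym_group ?m)"
  have gv: "g (n - 1) \<in> {1..n}" "g n \<in> {1..n}" "g (n - 1) \<noteq> g n"
    using permutes_in_image[OF g, of "n - 1"] permutes_in_image[OF g, of n]
      inj_eq[OF permutes_inj[OF g]] n by simp_all
  have "f i (\<sigma> \<circ> h \<circ> g) = v (h (g (n - 1))) (h (g n))" if "h \<in> ?H" for h
  proof -
    have "h permutes {1..n}" using that permutes_subset[of h "{1..?m}" "{1..n}"]
      by (auto simp: carrier_sym_group)
    then have "\<sigma> \<circ> h \<circ> g permutes {1..n}"
      using \<sigma> g by (intro permutes_compose)
    then show ?thesis
      using right_invariant_pair_value[OF _ inv i] n by (simp add: v_def)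
  qed
  then have eq: "(\<Sum>h\<in>?H. f i (\<sigma> \<circ> h \<circ> g)) = (\<Sum>h\<in>?H. v (h (g (n - 1))) (h (g n)))"
    by simp
  have fixed: "h x = x" if "h \<in> ?H" "\<not> x \<le> ?m" for h x
    using that permutes_not_in[of h "{1..?m}" x] by (auto simp: carrier_sym_group)
  have fin: "finite ?H" "card ?H = fact ?m"
    by (simp_all add: carrier_sym_group finite_permutations card_permutations)
  show ?thesis
  \<comment> \<open>Since \<open>h\<close> moves only points up to \<open>?m\<close>, the four cases
    average over two, one, one or no moving points.\<close>
  proof (cases "g (n - 1) \<le> ?m"; cases "g n \<le> ?m")
    assume *: "g (n - 1) \<le> ?m" "g n \<le> ?m"
    \<comment> \<open>Since \<open>\<sigma>\<close> maps the points other than \<open>x\<close> onto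
      those other than \<open>\<sigma> x\<close>, the full row is a row total; only the terms for
      \<open>n - 1\<close> and \<open>n\<close> have to be removed.\<close>
    have row: "(\<Sum>y\<in>{1..?m} - {x}. v x y) = row_total n (f i) (\<sigma> x) - v x (n - 1) - v x n"
      if x: "x \<in> {1..?m}" for x
    proof -
      have "bij_betw \<sigma> ({1..n} - {x}) ({1..n} - {\<sigma> x})"
        using permutes_imp_bij[OF \<sigma>] permutes_in_image[OF \<sigma>, of x] x by (intro bij_betw_DiffI) auto
      from sum.reindex_bij_betw[OF this, of "pair_value n (f i) (\<sigma> x)"]
      have "row_total n (f i) (\<sigma> x) = (\<Sum>y\<in>{1..n} - {x}. v x y)"
        by (simp add: row_total_def v_def)
      also have "{1..n} - {x} = insert (n - 1) (insert n ({1..?m} - {x}))" using x n by auto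
      also have "(\<Sum>y\<in>\<dots>. v x y) = v x (n - 1) + (v x n + (\<Sum>y\<in>{1..?m} - {x}. v x y))"
        using n by (subst sum.insert; (subst sum.insert)?) auto
      finally show ?thesis by simp
    qed
    have "(\<Sum>h\<in>?H. v (h (g (n - 1))) (h (g n)))
        = fact ?m / of_nat (?m * (?m - 1)) * (\<Sum>x = 1..?m. \<Sum>y\<in>{1..?m} - {x}. v x y)"
      by (rule sum_sym_group_apply2) (use * gv in auto)
    also have "(\<Sum>x = 1..?m. \<Sum>y\<in>{1..?m} - {x}. v x y)
        = (\<Sum>x = 1..?m. row_total n (f i) (\<sigma> x) - v x (n - 1) - v x n)"
      by (rule sum.cong[OF refl row])
    also have "?m - 1 = n - 3" by simp
    finally show ?thesis using * by (simp add: eq sum_distrib_left)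
  next
    assume *: "g (n - 1) \<le> ?m" "\<not> g n \<le> ?m"
    have "(\<Sum>h\<in>?H. v (h (g (n - 1))) (h (g n))) = (\<Sum>h\<in>?H. v (h (g (n - 1))) (g n))"
      by (rule sum.cong[OF refl]) (simp only: fixed[OF _ *(2)])
    also have "\<dots> = fact ?m / of_nat ?m * (\<Sum>x = 1..?m. v x (g n))"
      by (rule sum_sym_group_apply) (use * gv in auto)
    finally show ?thesis using * by (simp add: eq sum_distrib_left)
  next
    assume *: "\<not> g (n - 1) \<le> ?m" "g n \<le> ?m"
    have "(\<Sum>h\<in>?H. v (h (g (n - 1))) (h (g n))) = (\<Sum>h\<in>?H. v (g (n - 1)) (h (g n)))"
      by (rule sum.cong[OF refl]) (simp only: fixed[OF _ *(1)])
    also have "\<dots> = fact ?m / of_nat ?m * (\<Sum>x = 1..?m. v (g (n - 1)) x)"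
      by (rule sum_sym_group_apply) (use * gv in auto)
    finally show ?thesis using * by (simp add: eq sum_distrib_left)
  next
    assume *: "\<not> g (n - 1) \<le> ?m" "\<not> g n \<le> ?m"
    have "(\<Sum>h\<in>?H. v (h (g (n - 1))) (h (g n))) = (\<Sum>h\<in>?H. v (g (n - 1)) (g n))"
      by (rule sum.cong[OF refl]) (simp only: fixed[OF _ *(1)] fixed[OF _ *(2)])
    then show ?thesis using * fin by (simp add: eq)
  qed
qed

subsection \<open>Programs that compute a set of quantities\<close>

lemma run_program_Nil [simp]: "run_program env [] = []"
  by (simp add: run_program_def)

lemma run_program_snoc:
  "run_program env (P @ [c]) = run_program env P @ [instr_value env (run_program env P) c]"
  by (simp add: run_program_def)

lemma length_run_program [simp]: "length (run_program env P) = length P"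
  by (induction P rule: rev_induct) (simp_all add: run_program_snoc)

lemma wf_operand_mono: "wf_operand X m a \<Longrightarrow> m \<le> m' \<Longrightarrow> wf_operand X m' a"
  by (cases a) auto

lemma operand_value_append:
  "wf_operand X (length rs) a \<Longrightarrow> operand_value env (rs @ rs') a = operand_value env rs a"
  by (cases a) (auto simp: nth_append)

lemma wf_program_snoc:
  "wf_program X (P @ [c]) \<longleftrightarrow> wf_program X P \<and> wf_instr X (length P) c"
  by (auto simp: wf_program_def nth_append less_Suc_eq)

text \<open>Quantities are functions of the datum \<open>f\<close> that is presented to the program as \<open>env f\<close>;
  they need to be computed correctly only for data in \<open>E\<close>.\<close>

definition computable ::
    "'x set \<Rightarrow> ('f \<Rightarrow> 'x \<Rightarrow> complex) \<Rightarrow> 'f set \<Rightarrow> nat \<Rightarrow> ('f \<Rightarrow> complex) set \<Rightarrow> bool"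
  where "computable X env E N G \<longleftrightarrow> (\<exists>P. wf_program X P \<and> length P \<le> N \<and>
     (\<forall>\<phi>\<in>G. \<exists>a. wf_operand X (length P) a \<and>
        (\<forall>f\<in>E. operand_value (env f) (run_program (env f) P) a = \<phi> f)))"

lemma computable_inputs:
  "computable X env E 0 ({\<phi>. \<exists>x\<in>X. \<forall>f\<in>E. env f x = \<phi> f} \<union> range (\<lambda>c f. c))"
proof -
  have "\<exists>a. wf_operand X 0 a \<and> (\<forall>f\<in>E. operand_value (env f) [] a = \<phi> f)"
    if "\<phi> \<in> {\<phi>. \<exists>x\<in>X. \<forall>f\<in>E. env f x = \<phi> f} \<union> range (\<lambda>c f. c)" for \<phi>
    using that
  proof
    assume "\<phi> \<in> {\<phi>. \<exists>x\<in>X. \<forall>f\<in>E. env f x = \<phi> f}"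
    then obtain x where "x \<in> X" "\<forall>f\<in>E. env f x = \<phi> f" by blast
    then show ?thesis by (intro exI[of _ "Input x"]) simp
  next
    assume "\<phi> \<in> range (\<lambda>c f. c)"
    then obtain c where "\<phi> = (\<lambda>f. c)" by blast
    then show ?thesis by (intro exI[of _ "Const c"]) simp
  qed
  then show ?thesis
    unfolding computable_def by (intro exI[of _ "[]"]) (simp add: wf_program_def)
qed

lemma computable_mono:
  assumes "computable X env E N G" "N \<le> N'" "G' \<subseteq> G"
  shows "computable X env E N' G'"
  using assms unfolding computable_def by (meson le_trans subsetD)

lemma computable_cong:
  assumes "computable X env E N G" and "\<And>\<psi>. \<psi> \<in> G' \<Longrightarrow> \<exists>\<phi>\<in>G. \<forall>f\<in>E. \<phi> f = \<psi> f"
  shows "computable X env E N G'"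
proof -
  obtain P where P: "wf_program X P" "length P \<le> N"
    and G: "\<forall>\<phi>\<in>G. \<exists>a. wf_operand X (length P) a \<and>
        (\<forall>f\<in>E. operand_value (env f) (run_program (env f) P) a = \<phi> f)"
    using assms(1) unfolding computable_def by blast
  have "\<exists>a. wf_operand X (length P) a \<and>
      (\<forall>f\<in>E. operand_value (env f) (run_program (env f) P) a = \<psi> f)" if "\<psi> \<in> G'" for \<psi>
    using assms(2)[OF that] G by metis
  with P show ?thesis unfolding computable_def by blast
qed

text \<open>The function \<open>a\<close> records where the old quantities are found and
  \<open>c\<close> builds the new instruction from these operands. Registers are never overwritten,
  so the old operands stay valid.\<close>

lemma computable_snoc:
  assumes G: "computable X env E N G"
    and c: "\<And>m a. \<forall>\<phi>\<in>G. wf_operand X m (a \<phi>) \<Longrightarrow> wf_instr X m (c a)"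
    and val: "\<And>rs a f. f \<in> E \<Longrightarrow> \<forall>\<phi>\<in>G. operand_value (env f) rs (a \<phi>) = \<phi> f \<Longrightarrow>
      instr_value (env f) rs (c a) = \<psi> f"
  shows "computable X env E (Suc N) (insert \<psi> G)"
proof -
  obtain P a where P: "wf_program X P" "length P \<le> N"
    and a: "\<forall>\<phi>\<in>G. wf_operand X (length P) (a \<phi>) \<and>
        (\<forall>f\<in>E. operand_value (env f) (run_program (env f) P) (a \<phi>) = \<phi> f)"
    using G unfolding computable_def by metis
  let ?Q = "P @ [c a]"
  have wf: "wf_program X ?Q" using P a c by (simp add: wf_program_snoc)
  have new: "wf_operand X (length ?Q) (Reg (length P)) \<and>
      (\<forall>f\<in>E. operand_value (env f) (run_program (env f) ?Q) (Reg (length P)) = \<psi> f)"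
    using val a by (simp add: run_program_snoc nth_append)
  have old: "wf_operand X (length ?Q) (a \<phi>) \<and>
      (\<forall>f\<in>E. operand_value (env f) (run_program (env f) ?Q) (a \<phi>) = \<phi> f)" if "\<phi> \<in> G" for \<phi>
    using a that operand_value_append[of X "run_program (env f) P" "a \<phi>" for f]
    by (auto simp: run_program_snoc intro: wf_operand_mono)
  show ?thesis
    unfolding computable_def
  proof (intro exI[of _ ?Q] conjI ballI)
    fix \<phi> assume "\<phi> \<in> insert \<psi> G"
    then show "\<exists>b. wf_operand X (length ?Q) b \<and>
        (\<forall>f\<in>E. operand_value (env f) (run_program (env f) ?Q) b = \<phi> f)"
    proof
      assume "\<phi> = \<psi>"
      with new show ?thesis by blast
    next
      assume "\<phi> \<in> G"
      with old show ?thesis by blast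
    qed
  qed (use wf P in auto)
qed

lemma computable_add:
  assumes "computable X env E N G" "\<phi> \<in> G" "\<chi> \<in> G"
  shows "computable X env E (Suc N) (insert (\<lambda>f. \<phi> f + \<chi> f) G)"
  by (rule computable_snoc[OF assms(1), of "\<lambda>a. Add (a \<phi>) (a \<chi>)"]) (use assms in auto)

lemma computable_mult:
  assumes "computable X env E N G" "\<phi> \<in> G" "\<chi> \<in> G"
  shows "computable X env E (Suc N) (insert (\<lambda>f. \<phi> f * \<chi> f) G)"
  by (rule computable_snoc[OF assms(1), of "\<lambda>a. Mul (a \<phi>) (a \<chi>)"]) (use assms in auto)

lemma computable_cnj:
  assumes "computable X env E N G" "\<phi> \<in> G"
  shows "computable X env E (Suc N) (insert (\<lambda>f. cnj (\<phi> f)) G)"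
  by (rule computable_snoc[OF assms(1), of "\<lambda>a. Conj (a \<phi>)"]) (use assms in auto)

section \<open>Cost of sums of products\<close>

text \<open>The common form of all later computations. Linear combinations are included once
  \<open>G\<close> contains the constants. The parameter \<open>N\<close> counts products.\<close>

definition sum_of_products :: "'f set \<Rightarrow> ('f \<Rightarrow> complex) set \<Rightarrow> nat \<Rightarrow> ('f \<Rightarrow> complex) \<Rightarrow> bool"
  where "sum_of_products E G N \<psi> \<longleftrightarrow> (\<exists>ps. length ps \<le> N \<and> set ps \<subseteq> G \<times> G \<and>
     (\<forall>f\<in>E. \<psi> f = (\<Sum>(\<phi>, \<chi>)\<leftarrow>ps. \<phi> f * \<chi> f)))"

lemma sum_of_products_cong:
  "sum_of_products E G N \<phi> \<Longrightarrow> (\<And>f. f \<in> E \<Longrightarrow> \<psi> f = \<phi> f) \<Longrightarrow> sum_of_products E G N \<psi>"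
  by (simp add: sum_of_products_def)

lemma sum_of_products_mono:
  "sum_of_products E G N \<psi> \<Longrightarrow> N \<le> N' \<Longrightarrow> G \<subseteq> G' \<Longrightarrow> sum_of_products E G' N' \<psi>"
  unfolding sum_of_products_def by (meson Sigma_mono le_trans subset_trans)

lemma sum_of_products_mult:
  "\<phi> \<in> G \<Longrightarrow> \<chi> \<in> G \<Longrightarrow> sum_of_products E G 1 (\<lambda>f. \<phi> f * \<chi> f)"
  unfolding sum_of_products_def by (rule exI[of _ "[(\<phi>, \<chi>)]"]) simp

lemma sum_of_products_single:
  "\<phi> \<in> G \<Longrightarrow> range (\<lambda>c f. c) \<subseteq> G \<Longrightarrow> sum_of_products E G 1 (\<lambda>f. c * \<phi> f)"
  using sum_of_products_mult[of "\<lambda>f. c" G \<phi>] by auto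

lemma sum_of_products_add:
  assumes "sum_of_products E G M \<phi>" "sum_of_products E G N \<psi>"
  shows "sum_of_products E G (M + N) (\<lambda>f. \<phi> f + \<psi> f)"
proof -
  obtain ps qs where "length ps \<le> M" "set ps \<subseteq> G \<times> G" "\<forall>f\<in>E. \<phi> f = (\<Sum>(\<phi>, \<chi>)\<leftarrow>ps. \<phi> f * \<chi> f)"
    "length qs \<le> N" "set qs \<subseteq> G \<times> G" "\<forall>f\<in>E. \<psi> f = (\<Sum>(\<phi>, \<chi>)\<leftarrow>qs. \<phi> f * \<chi> f)"
    using assms unfolding sum_of_products_def by metis
  then show ?thesis
    unfolding sum_of_products_def by (intro exI[of _ "ps @ qs"]) auto
qed

lemma sum_of_products_sum:
  assumes "finite A" "\<And>k. k \<in> A \<Longrightarrow> sum_of_products E G N (\<psi> k)"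
  shows "sum_of_products E G (card A * N) (\<lambda>f. \<Sum>k\<in>A. \<psi> k f)"
  using assms
proof (induction A rule: finite_induct)
  case empty
  show ?case unfolding sum_of_products_def by (rule exI[of _ "[]"]) simp
next
  case (insert k A)
  then show ?case using sum_of_products_add[of E G N "\<psi> k" "card A * N"] by simp
qed

text \<open>Every product costs one multiplication and one addition, starting from the constant
  0.\<close>

lemma computable_sum_of_products:
  assumes G: "computable X env E N G" and const: "range (\<lambda>c f. c) \<subseteq> G"
    and \<psi>: "sum_of_products E G M \<psi>"
  shows "computable X env E (N + 2 * M) (insert \<psi> G)"
proof -
  obtain ps where ps: "length ps \<le> M" "set ps \<subseteq> G \<times> G" "\<forall>f\<in>E. \<psi> f = (\<Sum>(\<phi>, \<chi>)\<leftarrow>ps. \<phi> f * \<chi> f)"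
    using \<psi> unfolding sum_of_products_def by metis
  have "computable X env E (N + 2 * length ps) (insert (\<lambda>f. \<Sum>(\<phi>, \<chi>)\<leftarrow>ps. \<phi> f * \<chi> f) G)"
    using ps(2)
  proof (induction ps)
    case Nil
    have "(\<lambda>f. 0) \<in> G" using const by auto
    then show ?case using G by (simp add: insert_absorb)
  next
    case (Cons p ps)
    obtain \<phi> \<chi> where p: "p = (\<phi>, \<chi>)" by (cases p)
    let ?s = "\<lambda>f. \<Sum>(\<phi>, \<chi>)\<leftarrow>ps. \<phi> f * \<chi> f"
    let ?t = "\<lambda>f. \<phi> f * \<chi> f"
    have "computable X env E (Suc (N + 2 * length ps)) (insert ?t (insert ?s G))"
      using Cons p by (intro computable_mult) auto
    then have "computable X env E (Suc (Suc (N + 2 * length ps)))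
        (insert (\<lambda>f. ?t f + ?s f) (insert ?t (insert ?s G)))"
      by (rule computable_add) auto
    then show ?case
      by (rule computable_mono) (auto simp: p)
  qed
  then have "computable X env E (N + 2 * M) (insert (\<lambda>f. \<Sum>(\<phi>, \<chi>)\<leftarrow>ps. \<phi> f * \<chi> f) G)"
    by (rule computable_mono) (use ps in auto)
  then show ?thesis
    by (rule computable_cong) (use ps(3) in auto)
qed

text \<open>The step is required for all larger \<open>G'\<close> because the members computed
  earlier remain available.\<close>

lemma computable_family:
  assumes G: "computable X env E N G" and J: "finite J"
    and step: "\<And>j N' G'. j \<in> J \<Longrightarrow> G \<subseteq> G' \<Longrightarrow> computable X env E N' G' \<Longrightarrow>
      computable X env E (N' + M) (insert (\<psi> j) G')"
  shows "computable X env E (N + card J * M) (G \<union> \<psi> ` J)"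
  using J step
proof (induction J rule: finite_induct)
  case empty
  then show ?case using G by simp
next
  case (insert j J)
  then have "computable X env E (N + card J * M + M) (insert (\<psi> j) (G \<union> \<psi> ` J))"
    by auto
  then show ?case
    using insert.hyps by (simp add: algebra_simps)
qed

lemma computable_family_sum_of_products:
  assumes G: "computable X env E N G" and J: "finite J" and const: "range (\<lambda>c f. c) \<subseteq> G"
    and "\<And>j. j \<in> J \<Longrightarrow> sum_of_products E G M (\<psi> j)"
  shows "computable X env E (N + card J * (2 * M)) (G \<union> \<psi> ` J)"
proof (rule computable_family[OF G J])
  fix j N' G' assume "j \<in> J" and sub: "G \<subseteq> G'" and G': "computable X env E N' G'"
  then have "sum_of_products E G' M (\<psi> j)"
    using assms(4) sum_of_products_mono by blast
  then show "computable X env E (N' + 2 * M) (insert (\<psi> j) G')"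
    using computable_sum_of_products[OF G'] const sub by blast
qed

lemma computable_family_cnj:
  assumes G: "computable X env E N G" and J: "finite J" and "\<psi> ` J \<subseteq> G"
  shows "computable X env E (N + card J) (G \<union> (\<lambda>j f. cnj (\<psi> j f)) ` J)"
proof -
  have "computable X env E (N + card J * 1) (G \<union> (\<lambda>j f. cnj (\<psi> j f)) ` J)"
  proof (rule computable_family[OF G J])
    fix j N' G' assume "j \<in> J" "G \<subseteq> G'" and G': "computable X env E N' G'"
    then have "\<psi> j \<in> G'" using assms(3) by blast
    from computable_cnj[OF G' this]
    show "computable X env E (N' + 1) (insert (\<lambda>f. cnj (\<psi> j f)) G')" by simp
  qed
  then show ?thesis by simp
qed

subsection \<open>The program for the spectrum\<close>

context
  fixes n d :: nat
  assumes n: "4 \<le> n"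
begin

abbreviation "inv_funs \<equiv> {f. right_invariant n d f}"

abbreviation "spectrum_computable N G \<equiv> computable (table_positions n d) coset_table inv_funs N G"

abbreviation "table_values \<equiv>
  {\<phi>. \<exists>x\<in>table_positions n d. \<forall>f\<in>inv_funs. coset_table f x = \<phi> f} \<union> range (\<lambda>c f. c)"

lemma table_value:
  assumes i: "i \<in> {1..d}" and g: "g permutes {1..n}"
  shows "(\<lambda>f. f i g) \<in> table_values"
proof -
  let ?H = "carrier (sym_group (n - 2))"
  define K where "K = g <#\<^bsub>sym_group n\<^esub> ?H"
  have K: "K = (\<lambda>h. g \<circ> h) ` ?H"
    by (auto simp: K_def l_coset_def sym_group_def)
  have id: "id \<in> ?H" by (simp add: carrier_sym_group permutes_id)
  have "(i, K) \<in> table_positions n d"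
    using i g by (auto simp: table_positions_def LCOSETS_def K_def carrier_sym_group)
  moreover have "coset_table f (i, K) = f i g" if "f \<in> inv_funs" for f
  proof -
    have "f i (g \<circ> h) = f i g" if "h \<in> ?H" for h
      using \<open>f \<in> inv_funs\<close> i g that by (auto simp: right_invariant_def carrier_sym_group)
    then have "f i ` K = {f i g}" unfolding K image_image using id by auto
    then show ?thesis by (simp add: coset_table_def)
  qed
  ultimately show ?thesis by blast
qed

lemma pair_value_table:
  assumes "i \<in> {1..d}" "x \<in> {1..n}" "y \<in> {1..n}"
  shows "(\<lambda>f. pair_value n (f i) x y) \<in> table_values"
  unfolding pair_value_def
  by (rule table_value[OF assms(1) pair_perm_permutes]) (use n assms in auto)

lemma row_total_sum_of_products:
  assumes i: "i \<in> {1..d}" and x: "x \<in> {1..n}" and G: "table_values \<subseteq> G"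
  shows "sum_of_products inv_funs G n (\<lambda>f. row_total n (f i) x)"
proof -
  have "sum_of_products inv_funs G (card ({1..n} - {x}) * 1)
      (\<lambda>f. \<Sum>y\<in>{1..n} - {x}. 1 * pair_value n (f i) x y)"
  proof (rule sum_of_products_sum)
    fix y assume "y \<in> {1..n} - {x}"
    then have "(\<lambda>f. pair_value n (f i) x y) \<in> G"
      using subsetD[OF G pair_value_table[OF i x, of y]] by simp
    then show "sum_of_products inv_funs G 1 (\<lambda>f. 1 * pair_value n (f i) x y)"
      by (rule sum_of_products_single) (use G in auto)
  qed simp
  then have "sum_of_products inv_funs G n (\<lambda>f. \<Sum>y\<in>{1..n} - {x}. 1 * pair_value n (f i) x y)"
    by (rule sum_of_products_mono) (simp_all add: card_Diff_singleton_if)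
  then show ?thesis by (simp add: row_total_def)
qed

abbreviation stab_sum :: "nat \<times> (nat \<Rightarrow> nat) \<times> nat \<times> nat \<Rightarrow> (nat \<Rightarrow> (nat \<Rightarrow> nat) \<Rightarrow> complex) \<Rightarrow> complex"
  where "stab_sum \<equiv> \<lambda>(i, g, a, b) f.
    \<Sum>h\<in>carrier (sym_group (n - 2)). f i (coset_rep n a b \<circ> h \<circ> g)"

text \<open>There are at most \<open>n - 2\<close> values of \<open>x\<close>, each with at most
  three products: a row total and its two corrections.\<close>

lemma stab_sum_sum_of_products:
  assumes i: "i \<in> {1..d}" and g: "g \<in> double_coset_reps n" and ab: "a \<in> {1..n}" "b \<in> {1..n - 1}"
    and G: "table_values \<subseteq> G" "(\<lambda>(i, x) f. row_total n (f i) x) ` ({1..d} \<times> {1..n}) \<subseteq> G"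
  shows "sum_of_products inv_funs G (3 * n) (stab_sum (i, g, a, b))"
proof -
  let ?m = "n - 2"
  define \<sigma> where "\<sigma> = coset_rep n a b"
  define v where "v x y f = pair_value n (f i) (\<sigma> x) (\<sigma> y)" for x y and f :: "nat \<Rightarrow> (nat \<Rightarrow> nat) \<Rightarrow> complex"
  have g': "g permutes {1..n}" using double_coset_reps_permutes[OF n g] .
  have \<sigma>: "\<sigma> permutes {1..n}" unfolding \<sigma>_def using ab by (intro coset_rep_permutes) auto
  have const: "range (\<lambda>c f. c) \<subseteq> G" using G(1) by auto
  have gv: "g (n - 1) \<in> {1..n}" "g n \<in> {1..n}"
    using permutes_in_image[OF g', of "n - 1"] permutes_in_image[OF g', of n] n by simp_all
  have v: "sum_of_products inv_funs G 1 (\<lambda>f. c * v x y f)" if "x \<in> {1..n}" "y \<in> {1..n}" for c x y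
  proof (rule sum_of_products_single[OF _ const])
    have "(\<lambda>f. pair_value n (f i) (\<sigma> x) (\<sigma> y)) \<in> table_values"
      using that permutes_in_image[OF \<sigma>] by (intro pair_value_table[OF i]) blast+
    from subsetD[OF G(1) this] show "v x y \<in> G" by (simp add: v_def[abs_def])
  qed
  have eq: "stab_sum (i, g, a, b) f =
    (if g (n - 1) \<le> ?m then
       if g n \<le> ?m then \<Sum>x = 1..?m. fact ?m / of_nat (?m * (n - 3)) *
         (row_total n (f i) (\<sigma> x) - v x (n - 1) f - v x n f)
       else \<Sum>x = 1..?m. fact ?m / of_nat ?m * v x (g n) f
     else if g n \<le> ?m then \<Sum>x = 1..?m. fact ?m / of_nat ?m * v (g (n - 1)) x f
     else fact ?m * v (g (n - 1)) (g n) f)" if "f \<in> inv_funs" for f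
    using sum_stabiliser[OF n _ i \<sigma> g', of f] that by (simp only: mem_Collect_eq prod.case v_def \<sigma>_def)
  have sum3: "sum_of_products inv_funs G (3 * n) (\<lambda>f. \<Sum>x = 1..?m. \<psi> x f)"
    if "\<And>x. x \<in> {1..?m} \<Longrightarrow> sum_of_products inv_funs G M (\<psi> x)" "M \<le> 3" for \<psi> M
  proof (rule sum_of_products_mono)
    show "sum_of_products inv_funs G (card {1..?m} * M) (\<lambda>f. \<Sum>x = 1..?m. \<psi> x f)"
      by (rule sum_of_products_sum[OF _ that(1)]) simp
    show "card {1..?m} * M \<le> 3 * n" using mult_le_mono[of ?m n M 3] that(2) by simp
  qed simp
  consider "g (n - 1) \<le> ?m" "g n \<le> ?m" | "g (n - 1) \<le> ?m" "\<not> g n \<le> ?m"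
    | "\<not> g (n - 1) \<le> ?m" "g n \<le> ?m" | "\<not> g (n - 1) \<le> ?m" "\<not> g n \<le> ?m" by blast
  then show ?thesis
  proof cases
    case 1
    define c :: complex where "c = fact ?m / of_nat (?m * (n - 3))"
    have "sum_of_products inv_funs G (3 * n) (\<lambda>f. \<Sum>x = 1..?m.
        c * row_total n (f i) (\<sigma> x) + (- c * v x (n - 1) f + - c * v x n f))"
    proof (rule sum3)
      fix x assume x: "x \<in> {1..?m}"
      have "\<sigma> x \<in> {1..n}" using permutes_in_image[OF \<sigma>, of x] x by auto
      then have "(\<lambda>f. row_total n (f i) (\<sigma> x)) \<in> G" using G(2) i by force
      note R = sum_of_products_single[OF this const]
      show "sum_of_products inv_funs G (1 + (1 + 1)) (\<lambda>f.
          c * row_total n (f i) (\<sigma> x) + (- c * v x (n - 1) f + - c * v x n f))"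
        by (intro sum_of_products_add R v) (use n x in auto)
    qed simp
    then show ?thesis
      by (rule sum_of_products_cong) (simp only: eq 1 if_True c_def[symmetric], simp add: algebra_simps)
  next
    case 2
    have "sum_of_products inv_funs G (3 * n) (\<lambda>f. \<Sum>x = 1..?m. fact ?m / of_nat ?m * v x (g n) f)"
      by (rule sum3[OF v]) (use gv in auto)
    then show ?thesis
      by (rule sum_of_products_cong) (simp only: eq 2 if_True if_False)
  next
    case 3
    have "sum_of_products inv_funs G (3 * n) (\<lambda>f. \<Sum>x = 1..?m. fact ?m / of_nat ?m * v (g (n - 1)) x f)"
      by (rule sum3[OF v]) (use gv in auto)
    then show ?thesis
      by (rule sum_of_products_cong) (simp only: eq 3 if_True if_False)
  next
    case 4
    have "sum_of_products inv_funs G 1 (\<lambda>f. fact ?m * v (g (n - 1)) (g n) f)"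
      by (rule v[OF gv])
    then have "sum_of_products inv_funs G (3 * n) (\<lambda>f. fact ?m * v (g (n - 1)) (g n) f)"
      by (rule sum_of_products_mono) (use n in auto)
    then show ?thesis
      by (rule sum_of_products_cong) (simp only: eq 4 if_False)
  qed
qed

text \<open>At most five breaks combine with \<open>n - 1\<close> values of \<open>b\<close>. Each
  pair costs one product of a constant, including \<open>1 / n!\<close>, with a partial sum that is
  already available.\<close>

lemma fourier_sum_of_products:
  assumes \<mu>: "\<mu> \<in> irreps n" and K: "K \<in> standard_tableaux \<mu>" and U: "U \<in> first_row_tableaux n \<mu>"
    and const: "range (\<lambda>c f. c) \<subseteq> G"
    and \<Phi>: "\<And>f a b. f \<in> E \<Longrightarrow> a \<in> {1..n} \<Longrightarrow> b \<in> {1..n - 1} \<Longrightarrow>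
      (\<Sum>h\<in>carrier (sym_group (n - 2)). \<phi> f (coset_rep n a b \<circ> h)) = \<Phi> a b f"
    and G: "\<And>a b. a \<in> {1..n} \<Longrightarrow> b \<in> {1..n - 1} \<Longrightarrow> (\<lambda>f. \<Sum>a' = 1..a. \<Phi> a' b f) \<in> G"
  shows "sum_of_products E G (5 * n) (\<lambda>f. fourier n (\<phi> f) \<mu> K U)"
proof -
  note shape = irreps_shape[OF n \<mu>]
  have U': "U \<in> standard_tableaux \<mu>" "first_row_upto \<mu> (n - 2) U"
    using U by (simp_all add: first_row_tableaux_def)
  let ?A = "breaks \<mu> K \<times> {1..n - 1}"
  let ?\<psi> = "\<lambda>p f. (1 / fact n * coset_coeff \<mu> K U (fst p) (snd p)) * (\<Sum>a' = 1..fst p. \<Phi> a' (snd p) f)"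
  have br: "breaks \<mu> K \<subseteq> {1..n}" using shape(1) by (auto simp: breaks_def)
  obtain c1 c2 where "lower_cells \<mu> \<subseteq> {c1, c2}" using shape(3) by blast
  then have "card (breaks \<mu> K) \<le> 5" by (rule card_breaks_le)
  then have cardA: "card ?A * 1 \<le> 5 * n"
    using mult_le_mono[of "card (breaks \<mu> K)" 5 "n - 1" n] by (simp add: card_cartesian_product)
  have "sum_of_products E G (card ?A * 1) (\<lambda>f. \<Sum>p\<in>?A. ?\<psi> p f)"
  proof (rule sum_of_products_sum)
    show "finite ?A" using br finite_subset by auto
    fix p assume "p \<in> ?A"
    then have "(\<lambda>f. \<Sum>a' = 1..fst p. \<Phi> a' (snd p) f) \<in> G" using br by (intro G) auto
    then show "sum_of_products E G 1 (?\<psi> p)" by (rule sum_of_products_single[OF _ const])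
  qed
  then have "sum_of_products E G (5 * n) (\<lambda>f. \<Sum>p\<in>?A. ?\<psi> p f)"
    by (rule sum_of_products_mono[OF _ cardA order_refl])
  then show ?thesis
  proof (rule sum_of_products_cong)
    fix f assume f: "f \<in> E"
    have "fourier n (\<phi> f) \<mu> K U = 1 / fact n *
        (\<Sum>a = 1..n. \<Sum>b = 1..n - 1. \<Phi> a b f * of_real (coset_mat \<mu> a b K U))"
      using n by (subst fourier_first_row[OF _ shape(1) K U']) (simp_all add: \<Phi>[OF f])
    also have "(\<Sum>a = 1..n. \<Sum>b = 1..n - 1. \<Phi> a b f * of_real (coset_mat \<mu> a b K U))
        = (\<Sum>(a, b)\<in>?A. coset_coeff \<mu> K U a b * (\<Sum>a' = 1..a. \<Phi> a' b f))"
      using sum_coset_mat[OF K, of "\<lambda>a b. \<Phi> a b f" U "n - 1"] n by (simp add: shape(1))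
    finally show "fourier n (\<phi> f) \<mu> K U = (\<Sum>p\<in>?A. ?\<psi> p f)"
      by (simp add: sum_distrib_left case_prod_unfold mult.assoc)
  qed
qed

abbreviation "tableau_triples \<equiv> SIGMA \<mu>:irreps n. standard_tableaux \<mu> \<times> first_row_tableaux n \<mu>"

lemma card_standard_tableaux_irreps:
  assumes \<mu>: "\<mu> \<in> irreps n"
  shows "card (standard_tableaux \<mu>) \<le> 2 * n\<^sup>2"
proof -
  obtain c1 c2 where "lower_cells \<mu> \<subseteq> {c1, c2}" using irreps_shape(3)[OF n \<mu>] by blast
  from card_standard_tableaux_le[OF this]
  have "card (standard_tableaux \<mu>) \<le> (Suc n)\<^sup>2" by (simp only: irreps_shape(1)[OF n \<mu>])
  \<comment> \<open>This turns \<open>(n + 1)^2\<close> into the bound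
    \<open>2 * n^2\<close>.\<close>
  moreover have "1 + 2 * n \<le> n * n" using n mult_le_mono1[of 4 n n] by linarith
  ultimately show ?thesis by (simp add: power2_eq_square)
qed

text \<open>Four shapes, each with at most \<open>2 * n^2\<close> rows and two columns.\<close>

lemma card_tableau_triples: "card tableau_triples \<le> 16 * n\<^sup>2"
proof -
  have V: "card (first_row_tableaux n \<mu>) \<le> 2" if "\<mu> \<in> irreps n" for \<mu>
  proof -
    have "card (first_row_tableaux n [n]) \<le> 2" "card (first_row_tableaux n [n - 1, 1]) \<le> 2"
      "card (first_row_tableaux n [n - 2, 2]) \<le> 2" "card (first_row_tableaux n [n - 2, 1, 1]) \<le> 2"
      using card_first_row_tableaux[OF n] by linarith+
    then show ?thesis using that unfolding irreps_def by blast
  qed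
  have "card tableau_triples = (\<Sum>\<mu>\<in>irreps n. card (standard_tableaux \<mu>) * card (first_row_tableaux n \<mu>))"
    by (simp add: card_SigmaI irreps_def finite_standard_tableaux finite_first_row_tableaux card_cartesian_product)
  also have "\<dots> \<le> (\<Sum>\<mu>\<in>irreps n. 2 * n\<^sup>2 * 2)"
    by (intro sum_mono mult_le_mono card_standard_tableaux_irreps V)
  also have "\<dots> = card (irreps n) * (4 * n\<^sup>2)" by simp
  also have "card (irreps n) \<le> 4" by (simp add: irreps_def card_insert_if)
  finally show ?thesis by simp
qed

lemma spectrum_computable_entries:
  "\<exists>G. spectrum_computable (1452 * (d\<^sup>2 * n ^ 3) + 196 * (d ^ 3 * n\<^sup>2)) G \<and>
    (\<lambda>(g, \<mu>, i, T, U) f. skew_spectrum n f g \<mu> (i, T) (i, U)) ` spectrum_support n d \<subseteq> G \<and>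
    range (\<lambda>c f. c) \<subseteq> G"
proof -
  let ?D = "double_coset_reps n"
  let ?B = "d\<^sup>2 * n ^ 3"
  let ?AB = "{1..n} \<times> {1..n - 1}"
  have D: "finite ?D" "card ?D \<le> 7" by (simp add: double_coset_reps_def) (rule card_double_coset_reps)
  have Q: "finite tableau_triples"
    by (auto simp: irreps_def finite_standard_tableaux finite_first_row_tableaux)
  have dd: "d \<le> d\<^sup>2" by (simp add: power2_eq_square)
  have nn: "n \<le> n\<^sup>2" by (simp add: power2_eq_square)
  have AB: "card ?AB \<le> n\<^sup>2" by (simp add: card_cartesian_product power2_eq_square)
  \<comment> \<open>A family of at most \<open>j * d^2 * n^2\<close> quantities with
    \<open>k * n\<close> products each costs at most \<open>2 * j * k\<close> times
    \<open>?B\<close>.\<close>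
  have stage: "spectrum_computable (c' * ?B) (G \<union> \<psi> ` J)"
    if G: "spectrum_computable (c * ?B) G" and J: "finite J" "card J \<le> j * (d\<^sup>2 * n\<^sup>2)"
      and const: "table_values \<subseteq> G" and \<psi>: "\<And>j. j \<in> J \<Longrightarrow> sum_of_products inv_funs G (k * n) (\<psi> j)"
      and c': "c' = c + 2 * (j * k)"
    for c c' j k G and J :: "'j set" and \<psi>
  proof (rule computable_mono[OF computable_family_sum_of_products[OF G J(1) _ \<psi>] _ order_refl])
    have "card J * (2 * (k * n)) \<le> (j * (d\<^sup>2 * n\<^sup>2)) * (2 * (k * n))"
      using J(2) by (rule mult_right_mono) simp
    also have "\<dots> = 2 * (j * k) * ?B" by (simp add: power2_eq_square power3_eq_cube)
    finally show "c * ?B + card J * (2 * (k * n)) \<le> c' * ?B"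
      by (simp add: c' add_mult_distrib)
    show "range (\<lambda>c f. c) \<subseteq> G" using const by (rule order_trans[rotated]) simp
  qed

  define J1 where "J1 = {1..d} \<times> {1..n}"
  define \<psi>1 :: "nat \<times> nat \<Rightarrow> (nat \<Rightarrow> (nat \<Rightarrow> nat) \<Rightarrow> complex) \<Rightarrow> complex"
    where "\<psi>1 = (\<lambda>(i, x) f. row_total n (f i) x)"
  define G1 where "G1 = table_values \<union> \<psi>1 ` J1"
  have c1: "spectrum_computable (2 * ?B) G1"
    unfolding G1_def
  proof (rule stage)
    show "spectrum_computable (0 * ?B) table_values"
      using computable_inputs[of "table_positions n d" coset_table inv_funs] by simp
    show "finite J1" "card J1 \<le> 1 * (d\<^sup>2 * n\<^sup>2)"
      using mult_le_mono[OF dd nn] by (simp_all add: J1_def card_cartesian_product)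
    show "sum_of_products inv_funs table_values (1 * n) (\<psi>1 j)" if "j \<in> J1" for j
      using that row_total_sum_of_products[of "fst j" "snd j" table_values]
      by (auto simp: J1_def \<psi>1_def)
  qed simp_all
  have G1: "table_values \<subseteq> G1" "\<psi>1 ` J1 \<subseteq> G1" unfolding G1_def by blast+

  \<comment> \<open>The stabiliser sums of \<open>f i (\<sigma> h g)\<close>: here
    \<open>j = 7\<close> and \<open>k = 3\<close>, which adds 42 to the coefficient.\<close>
  define J2 where "J2 = {1..d} \<times> ?D \<times> ?AB"
  define G2 where "G2 = G1 \<union> stab_sum ` J2"
  have c2: "spectrum_computable (44 * ?B) G2"
    unfolding G2_def
  proof (rule stage[OF c1 _ _ G1(1)])
    show "finite J2" using D by (simp add: J2_def)
    have "card J2 = card ?D * (d * card ?AB)" by (simp add: J2_def card_cartesian_product)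
    also have "\<dots> \<le> 7 * (d\<^sup>2 * n\<^sup>2)" by (intro mult_le_mono D dd AB)
    finally show "card J2 \<le> 7 * (d\<^sup>2 * n\<^sup>2)" .
    show "sum_of_products inv_funs G1 (3 * n) (stab_sum j)" if "j \<in> J2" for j
    proof -
      obtain i g a b where j: "j = (i, g, a, b)" by (cases j) auto
      show ?thesis
        unfolding j by (rule stab_sum_sum_of_products)
          (use that G1 in \<open>auto simp: j J2_def \<psi>1_def J1_def\<close>)
    qed
  qed simp
  have G2: "table_values \<subseteq> G2" "stab_sum ` J2 \<subseteq> G2" using G1 unfolding G2_def by blast+

  have val: "(\<lambda>f. f i (coset_rep n a b)) \<in> table_values"
    if "i \<in> {1..d}" "a \<in> {1..n}" "b \<in> {1..n - 1}" for i a b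
    using that by (intro table_value coset_rep_permutes) auto
  \<comment> \<open>On a coset \<open>f i1\<close> is constant, so the stabiliser sum of the product
    in \<open>r_hat\<close> is this single product. Its partial sums in \<open>a\<close> are each
    formed afresh with at most \<open>n\<close> products, which still fits the bound.\<close>
  define \<Phi>3 where "\<Phi>3 i1 i2 g a b f = f i1 (coset_rep n a b) * stab_sum (i2, g, a, b) f"
    for i1 i2 :: nat and g a b f
  define J3 where "J3 = {1..d} \<times> {1..d} \<times> ?D \<times> ?AB"
  define \<psi>3 where "\<psi>3 = (\<lambda>(i1, i2, g, a, b) f. \<Sum>a' = 1..a. \<Phi>3 i1 i2 g a' b f)"
  define G3 where "G3 = G2 \<union> \<psi>3 ` J3"
  have c3: "spectrum_computable (58 * ?B) G3"
    unfolding G3_def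
  proof (rule stage[OF c2 _ _ G2(1)])
    show "finite J3" using D by (simp add: J3_def)
    have "card J3 = card ?D * (d * d * card ?AB)" by (simp add: J3_def card_cartesian_product)
    also have "\<dots> \<le> 7 * (d * d * n\<^sup>2)" by (intro mult_le_mono D AB order_refl)
    finally show "card J3 \<le> 7 * (d\<^sup>2 * n\<^sup>2)" by (simp add: power2_eq_square)
    show "sum_of_products inv_funs G2 (1 * n) (\<psi>3 j)" if "j \<in> J3" for j
    proof -
      obtain i1 i2 g a b where j: "j = (i1, i2, g, a, b)" by (cases j) auto
      have mem: "i1 \<in> {1..d}" "i2 \<in> {1..d}" "g \<in> ?D" "a \<in> {1..n}" "b \<in> {1..n - 1}"
        using that by (auto simp: j J3_def)
      have "sum_of_products inv_funs G2 (card {1..a} * 1) (\<lambda>f. \<Sum>a' = 1..a. \<Phi>3 i1 i2 g a' b f)"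
      proof (rule sum_of_products_sum)
        fix a' assume "a' \<in> {1..a}"
        then have a': "a' \<in> {1..n}" using mem by auto
        have "(i2, g, a', b) \<in> J2" using mem a' by (simp add: J2_def)
        then have "stab_sum (i2, g, a', b) \<in> G2" using G2(2) by blast
        from sum_of_products_mult[OF subsetD[OF G2(1) val[OF mem(1) a' mem(5)]] this]
        show "sum_of_products inv_funs G2 1 (\<Phi>3 i1 i2 g a' b)" by (simp add: \<Phi>3_def[abs_def])
      qed simp
      then have "sum_of_products inv_funs G2 (1 * n) (\<lambda>f. \<Sum>a' = 1..a. \<Phi>3 i1 i2 g a' b f)"
        by (rule sum_of_products_mono) (use mem in auto)
      then show ?thesis by (simp add: \<psi>3_def j)
    qed
  qed simp
  have G3: "table_values \<subseteq> G3" "\<psi>3 ` J3 \<subseteq> G3" using G2 unfolding G3_def by blast+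

  \<comment> \<open>The analogue for \<open>f i\<close> alone, where summing a constant over the
    stabiliser gives the factor \<open>(n - 2)!\<close>.\<close>
  define \<Phi>4 :: "nat \<Rightarrow> nat \<Rightarrow> nat \<Rightarrow> (nat \<Rightarrow> (nat \<Rightarrow> nat) \<Rightarrow> complex) \<Rightarrow> complex"
    where "\<Phi>4 i a b f = fact (n - 2) * f i (coset_rep n a b)" for i a b f
  define J4 where "J4 = {1..d} \<times> ?AB"
  define \<psi>4 where "\<psi>4 = (\<lambda>(i, a, b) f. \<Sum>a' = 1..a. \<Phi>4 i a' b f)"
  define G4 where "G4 = G3 \<union> \<psi>4 ` J4"
  have c4: "spectrum_computable (60 * ?B) G4"
    unfolding G4_def
  proof (rule stage[OF c3 _ _ G3(1)])
    show "finite J4" by (simp add: J4_def)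
    have "card J4 = d * card ?AB" by (simp add: J4_def card_cartesian_product)
    also have "\<dots> \<le> d\<^sup>2 * n\<^sup>2" by (intro mult_le_mono AB dd)
    finally show "card J4 \<le> 1 * (d\<^sup>2 * n\<^sup>2)" by simp
    show "sum_of_products inv_funs G3 (1 * n) (\<psi>4 j)" if "j \<in> J4" for j
    proof -
      obtain i a b where j: "j = (i, a, b)" by (cases j) auto
      have mem: "i \<in> {1..d}" "a \<in> {1..n}" "b \<in> {1..n - 1}"
        using that by (auto simp: j J4_def)
      have "sum_of_products inv_funs G3 (card {1..a} * 1) (\<lambda>f. \<Sum>a' = 1..a. \<Phi>4 i a' b f)"
      proof (rule sum_of_products_sum)
        fix a' assume "a' \<in> {1..a}"
        then have a': "a' \<in> {1..n}" using mem by auto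
        have "range (\<lambda>c f. c) \<subseteq> G3" using G3(1) by simp
        from sum_of_products_single[OF subsetD[OF G3(1) val[OF mem(1) a' mem(3)]] this]
        show "sum_of_products inv_funs G3 1 (\<Phi>4 i a' b)" by (simp add: \<Phi>4_def[abs_def])
      qed simp
      then have "sum_of_products inv_funs G3 (1 * n) (\<lambda>f. \<Sum>a' = 1..a. \<Phi>4 i a' b f)"
        by (rule sum_of_products_mono) (use mem in auto)
      then show ?thesis by (simp add: \<psi>4_def j)
    qed
  qed simp
  have G4: "table_values \<subseteq> G4" "\<psi>3 ` J3 \<subseteq> G4" "\<psi>4 ` J4 \<subseteq> G4"
    using G3 unfolding G4_def by blast+
  have const4: "range (\<lambda>c f. c) \<subseteq> G4" using G4(1) by simp
  have invh: "f i (coset_rep n a b \<circ> h) = f i (coset_rep n a b)"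
    if "f \<in> inv_funs" "i \<in> {1..d}" "a \<in> {1..n}" "b \<in> {1..n - 1}" "h \<in> carrier (sym_group (n - 2))"
    for f :: "nat \<Rightarrow> (nat \<Rightarrow> nat) \<Rightarrow> complex" and i a b h
  proof -
    have "coset_rep n a b \<in> carrier (sym_group n)"
      using that coset_rep_permutes[of a b n] by (simp add: carrier_sym_group)
    with that show ?thesis unfolding right_invariant_def by blast
  qed

  \<comment> \<open>The entries of \<open>r_hat\<close> in the columns that survive the projection.
    They number at most \<open>7 * 16 = 112\<close> times \<open>d^2 * n^2\<close>; with
    \<open>k = 5\<close> this is the dominant cost, 1120.\<close>
  define J5 where "J5 = ({1..d} \<times> {1..d} \<times> ?D) \<times> tableau_triples"
  define \<psi>5 :: "(nat \<times> nat \<times> (nat \<Rightarrow> nat)) \<times> nat list \<times> tableau \<times> tableau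
      \<Rightarrow> (nat \<Rightarrow> (nat \<Rightarrow> nat) \<Rightarrow> complex) \<Rightarrow> complex"
    where "\<psi>5 = (\<lambda>((i1, i2, g), \<mu>, K, T) f. r_hat n f i1 i2 g \<mu> K T)"
  define G5 where "G5 = G4 \<union> \<psi>5 ` J5"
  have finJ5: "finite J5" using D Q by (simp add: J5_def)
  have "card J5 = card ?D * card tableau_triples * (d * d)"
    by (simp add: J5_def card_cartesian_product)
  also have "\<dots> \<le> 7 * (16 * n\<^sup>2) * (d * d)" by (intro mult_le_mono D card_tableau_triples order_refl)
  finally have cardJ5: "card J5 \<le> 112 * (d\<^sup>2 * n\<^sup>2)"
    by (simp add: power2_eq_square mult.assoc mult.commute mult.left_commute)
  have c5: "spectrum_computable (1180 * ?B) G5"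
    unfolding G5_def
  proof (rule stage[OF c4 finJ5 cardJ5 G4(1)])
    show "sum_of_products inv_funs G4 (5 * n) (\<psi>5 j)" if "j \<in> J5" for j
    proof -
      obtain i1 i2 g \<mu> K T where j: "j = ((i1, i2, g), \<mu>, K, T)" by (metis prod.collapse)
      have mem: "i1 \<in> {1..d}" "i2 \<in> {1..d}" "g \<in> ?D" "\<mu> \<in> irreps n"
        "K \<in> standard_tableaux \<mu>" "T \<in> first_row_tableaux n \<mu>"
        using that by (simp_all add: j J5_def)
      have "sum_of_products inv_funs G4 (5 * n) (\<lambda>f. fourier n (\<lambda>g'. f i1 g' * f i2 (g' \<circ> g)) \<mu> K T)"
      proof (rule fourier_sum_of_products[OF mem(4,5,6) const4])
        fix f a b assume "f \<in> inv_funs" "a \<in> {1..n}" "b \<in> {1..n - 1}"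
        from invh[OF this(1) mem(1) this(2,3)]
        show "(\<Sum>h\<in>carrier (sym_group (n - 2)).
            f i1 (coset_rep n a b \<circ> h) * f i2 (coset_rep n a b \<circ> h \<circ> g)) = \<Phi>3 i1 i2 g a b f"
          by (simp add: \<Phi>3_def sum_distrib_left)
      next
        fix a b assume "a \<in> {1..n}" "b \<in> {1..n - 1}"
        then have "(i1, i2, g, a, b) \<in> J3" using mem by (simp add: J3_def)
        then have "\<psi>3 (i1, i2, g, a, b) \<in> G4" using G4(2) by blast
        then show "(\<lambda>f. \<Sum>a' = 1..a. \<Phi>3 i1 i2 g a' b f) \<in> G4" by (simp add: \<psi>3_def)
      qed
      then show ?thesis by (simp add: \<psi>5_def j r_hat_def)
    qed
  qed simp
  have G5: "table_values \<subseteq> G5" "\<psi>4 ` J4 \<subseteq> G5" "\<psi>5 ` J5 \<subseteq> G5"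
    using G4 unfolding G5_def by blast+
  have const5: "range (\<lambda>c f. c) \<subseteq> G5" using G5(1) by simp

  define J6 where "J6 = {1..d} \<times> tableau_triples"
  define \<psi>6 :: "nat \<times> nat list \<times> tableau \<times> tableau \<Rightarrow> (nat \<Rightarrow> (nat \<Rightarrow> nat) \<Rightarrow> complex) \<Rightarrow> complex"
    where "\<psi>6 = (\<lambda>(i, \<mu>, K, U) f. fourier n (f i) \<mu> K U)"
  define G6 where "G6 = G5 \<union> \<psi>6 ` J6"
  have c6: "spectrum_computable (1340 * ?B) G6"
    unfolding G6_def
  proof (rule stage[OF c5 _ _ G5(1)])
    show "finite J6" using Q by (simp add: J6_def)
    have "card J6 = d * card tableau_triples" by (simp add: J6_def card_cartesian_product)
    also have "\<dots> \<le> d\<^sup>2 * (16 * n\<^sup>2)" by (intro mult_le_mono card_tableau_triples dd)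
    finally show "card J6 \<le> 16 * (d\<^sup>2 * n\<^sup>2)" by simp
    show "sum_of_products inv_funs G5 (5 * n) (\<psi>6 j)" if "j \<in> J6" for j
    proof -
      obtain i \<mu> K U where j: "j = (i, \<mu>, K, U)" by (metis prod.collapse)
      have mem: "i \<in> {1..d}" "\<mu> \<in> irreps n"
        "K \<in> standard_tableaux \<mu>" "U \<in> first_row_tableaux n \<mu>"
        using that by (simp_all add: j J6_def)
      have "sum_of_products inv_funs G5 (5 * n) (\<lambda>f. fourier n (f i) \<mu> K U)"
      proof (rule fourier_sum_of_products[OF mem(2,3,4) const5])
        fix f a b assume "f \<in> inv_funs" "a \<in> {1..n}" "b \<in> {1..n - 1}"
        from invh[OF this(1) mem(1) this(2,3)]
        have "(\<Sum>h\<in>carrier (sym_group (n - 2)). f i (coset_rep n a b \<circ> h))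
            = of_nat (card (carrier (sym_group (n - 2)))) * f i (coset_rep n a b)" by simp
        then show "(\<Sum>h\<in>carrier (sym_group (n - 2)). f i (coset_rep n a b \<circ> h)) = \<Phi>4 i a b f"
          using order_sym_group[of "n - 2"] by (simp add: \<Phi>4_def order_def)
      next
        fix a b assume "a \<in> {1..n}" "b \<in> {1..n - 1}"
        then have "(i, a, b) \<in> J4" using mem by (simp add: J4_def)
        then have "\<psi>4 (i, a, b) \<in> G5" using G5(2) by blast
        then show "(\<lambda>f. \<Sum>a' = 1..a. \<Phi>4 i a' b f) \<in> G5" by (simp add: \<psi>4_def)
      qed
      then show ?thesis by (simp add: \<psi>6_def j)
    qed
  qed simp
  have G6: "range (\<lambda>c f. c) \<subseteq> G6" "\<psi>5 ` J5 \<subseteq> G6" "\<psi>6 ` J6 \<subseteq> G6"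
    using G5 const5 unfolding G6_def by blast+

  \<comment> \<open>The adjoint needs one conjugation for each entry of \<open>r_hat\<close>, adding
    112.\<close>
  define \<psi>7 where "\<psi>7 j f = cnj (\<psi>5 j f)" for j f
  define G7 where "G7 = G6 \<union> \<psi>7 ` J5"
  have "spectrum_computable (1340 * ?B + card J5) G7"
    unfolding G7_def \<psi>7_def[abs_def] by (rule computable_family_cnj[OF c6 finJ5 G6(2)])
  moreover have "card J5 \<le> 112 * ?B"
  proof -
    have "n\<^sup>2 \<le> n ^ 3" using n by (intro power_increasing) auto
    then have "112 * (d\<^sup>2 * n\<^sup>2) \<le> 112 * ?B" by simp
    with cardJ5 show ?thesis by (rule le_trans)
  qed
  ultimately have c7: "spectrum_computable (1452 * ?B) G7"
    by (elim computable_mono) auto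
  have G7: "range (\<lambda>c f. c) \<subseteq> G7" "\<psi>7 ` J5 \<subseteq> G7" "\<psi>6 ` J6 \<subseteq> G7"
    using G6 unfolding G7_def by blast+

  \<comment> \<open>At most \<open>49 * d^3\<close> entries with at most \<open>2 * n^2\<close>
    products each, two operations per product, give the coefficient 196.\<close>
  define \<psi>8 where "\<psi>8 = (\<lambda>(g, \<mu>, i, T, U) f. skew_spectrum n f g \<mu> (i, T) (i, U))"
  have "spectrum_computable (1452 * ?B + card (spectrum_support n d) * (2 * (2 * n\<^sup>2))) (G7 \<union> \<psi>8 ` spectrum_support n d)"
  proof (rule computable_family_sum_of_products[OF c7 _ G7(1)])
    show "finite (spectrum_support n d)"
      by (rule finite_spectrum_support)
    fix j assume mem': "j \<in> spectrum_support n d"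
    obtain g \<mu> i1 i2 i3 T U where j: "j = (g, \<mu>, (i1, i2, i3), T, U)" by (metis prod.collapse)
    have mem: "g \<in> ?D" "\<mu> \<in> irreps n" "i1 \<in> {1..d}" "i2 \<in> {1..d}" "i3 \<in> {1..d}"
      "T \<in> first_row_tableaux n \<mu>" "U \<in> first_row_tableaux n \<mu>"
      using mem' by (simp_all add: j spectrum_support_def)
    note TU = mem(6,7)[unfolded first_row_tableaux_def mem_Collect_eq]
    let ?S = "standard_tableaux \<mu>"
    have "sum_of_products inv_funs G7 (card ?S * 1)
        (\<lambda>f. \<Sum>K\<in>?S. \<psi>7 ((i1, i2, g), \<mu>, K, T) f * \<psi>6 (i3, \<mu>, K, U) f)"
    proof (rule sum_of_products_sum[OF finite_standard_tableaux sum_of_products_mult])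
      fix K assume K: "K \<in> ?S"
      have "((i1, i2, g), \<mu>, K, T) \<in> J5" using mem K by (simp add: J5_def)
      then show "\<psi>7 ((i1, i2, g), \<mu>, K, T) \<in> G7" using G7(2) by blast
      have "(i3, \<mu>, K, U) \<in> J6" using mem K by (simp add: J6_def)
      then show "\<psi>6 (i3, \<mu>, K, U) \<in> G7" using G7(3) by blast
    qed
    then have "sum_of_products inv_funs G7 (2 * n\<^sup>2)
        (\<lambda>f. \<Sum>K\<in>?S. \<psi>7 ((i1, i2, g), \<mu>, K, T) f * \<psi>6 (i3, \<mu>, K, U) f)"
      by (rule sum_of_products_mono) (use card_standard_tableaux_irreps[OF mem(2)] in auto)
    then show "sum_of_products inv_funs G7 (2 * n\<^sup>2) (\<psi>8 j)"
    proof (rule sum_of_products_cong)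
      fix f assume "f \<in> inv_funs"
      then show "\<psi>8 j f = (\<Sum>K\<in>?S. \<psi>7 ((i1, i2, g), \<mu>, K, T) f * \<psi>6 (i3, \<mu>, K, U) f)"
        using spectrum_block[OF _ irreps_shape(1,2)[OF n mem(2)] _ mem(5), of f T U g i1 i2] n TU
        by (simp add: \<psi>8_def j \<psi>7_def \<psi>5_def \<psi>6_def)
    qed
  qed
  moreover have "card (spectrum_support n d) * (2 * (2 * n\<^sup>2)) \<le> 196 * (d ^ 3 * n\<^sup>2)"
    using mult_le_mono1[OF card_spectrum_support[OF n, of d], of "2 * (2 * n\<^sup>2)"] by simp
  ultimately have "spectrum_computable (1452 * ?B + 196 * (d ^ 3 * n\<^sup>2)) (G7 \<union> \<psi>8 ` spectrum_support n d)"
    by (elim computable_mono) auto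
  then show ?thesis
    using G7(1) unfolding \<psi>8_def by blast
qed

lemma spectrum_program:
  "\<exists>P out. computes_spectrum n d P out \<and> length P \<le> 1452 * (d\<^sup>2 * n ^ 3) + 196 * (d ^ 3 * n\<^sup>2)"
proof -
  let ?N = "1452 * (d\<^sup>2 * n ^ 3) + 196 * (d ^ 3 * n\<^sup>2)"
  obtain G where G: "spectrum_computable ?N G"
    "(\<lambda>(g, \<mu>, i, T, U) f. skew_spectrum n f g \<mu> (i, T) (i, U)) ` spectrum_support n d \<subseteq> G"
    "range (\<lambda>c f. c) \<subseteq> G"
    using spectrum_computable_entries by blast
  have "\<exists>\<phi>\<in>G. \<forall>f\<in>inv_funs. \<phi> f = spectrum_entry n f e" if e: "e \<in> entry_indices n d" for e
  proof (cases "e \<in> (\<lambda>(g, \<mu>, i, T, U). (g, \<mu>, (i, T), (i, U))) ` spectrum_support n d")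
    case True
    then obtain g \<mu> i T U where s: "(g, \<mu>, i, T, U) \<in> spectrum_support n d" "e = (g, \<mu>, (i, T), (i, U))"
      by auto
    have "(\<lambda>(g, \<mu>, i, T, U) f. skew_spectrum n f g \<mu> (i, T) (i, U)) (g, \<mu>, i, T, U) \<in> G"
      using G(2) s(1) by blast
    then show ?thesis by (rule rev_bexI) (simp add: s(2) spectrum_entry_def)
  next
    case False
    \<comment> \<open>Entries off the support are read from the constant 0 at no cost.\<close>
    have "(\<lambda>f. 0) \<in> G" using G(3) by blast
    then show ?thesis
      by (rule rev_bexI) (simp add: spectrum_entry_outside_support[OF n _ e False])
  qed
  then have "spectrum_computable ?N ((\<lambda>e f. spectrum_entry n f e) ` entry_indices n d)"
    by (intro computable_cong[OF G(1)]) auto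
  then obtain P where P: "wf_program (table_positions n d) P" "length P \<le> ?N"
    and "\<forall>e\<in>entry_indices n d. \<exists>a. wf_operand (table_positions n d) (length P) a \<and>
      (\<forall>f\<in>inv_funs. operand_value (coset_table f) (run_program (coset_table f) P) a = spectrum_entry n f e)"
    unfolding computable_def by auto
  then obtain out where "\<forall>e\<in>entry_indices n d. wf_operand (table_positions n d) (length P) (out e) \<and>
      (\<forall>f\<in>inv_funs. operand_value (coset_table f) (run_program (coset_table f) P) (out e) = spectrum_entry n f e)"
    by metis
  with P show ?thesis unfolding computes_spectrum_def by blast
qed

end

theorem theorem3p2:
  shows "(\<exists>C::real. \<forall>n\<ge>4. \<forall>d\<ge>1. \<exists>P out.
            computes_spectrum n d P out \<and>
            real (length P) \<le> C * (real d ^ 2 * real n ^ 3 + real d ^ 3 * real n ^ 2))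
       \<and> (\<forall>n\<ge>4. \<forall>d\<ge>1. \<forall>f. right_invariant n d f \<longrightarrow>
            card {e \<in> entry_indices n d. spectrum_entry n f e \<noteq> 0} \<le> 49 * d ^ 3)"
proof (intro conjI exI[of _ "1452 :: real"] allI impI)
  fix n d :: nat assume n: "n \<ge> 4"
  obtain P out where P: "computes_spectrum n d P out"
    and len: "length P \<le> 1452 * (d\<^sup>2 * n ^ 3) + 196 * (d ^ 3 * n\<^sup>2)"
    using spectrum_program[OF n] by blast
  \<comment> \<open>Raising 196 to 1452 lets one constant serve both terms.\<close>
  from len have "length P \<le> 1452 * (d\<^sup>2 * n ^ 3 + d ^ 3 * n\<^sup>2)" by (simp add: add_mult_distrib2)
  then have "real (length P) \<le> real (1452 * (d\<^sup>2 * n ^ 3 + d ^ 3 * n\<^sup>2))" by (rule of_nat_mono)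
  with P show "\<exists>P out. computes_spectrum n d P out \<and>
      real (length P) \<le> 1452 * (real d ^ 2 * real n ^ 3 + real d ^ 3 * real n ^ 2)"
    by auto
qed (rule card_nonzero_entries)

end
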